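(* Let $p_\infty$ be the largest exponent $p$ such that the Riesz projection $P$ is bounded from $L^\infty(\mathbb{T}^\infty)$ to $L^p(\mathbb{T}^\infty)$. Then $p_\infty \leq p = 3.31138\ldots$, where $p$ denotes the unique positive solution of the equation \[{\Gamma\left(1+\frac{p}{2}\right)}^{\frac{1}{p}} = \frac{2}{\sqrt{\pi}}.\]
   Context: $\mathbb{T}^\infty = \mathbb{T}\times\mathbb{T}\times\cdots$ is the countably infinite cartesian product of $\mathbb{T}=\{z\in\mathbb{C} : |z|=1\}$, equipped with its Haar measure $\mu_\infty$ (the infinite product of the normalized Lebesgue arc measure on $\mathbb{T}$). $L^p(\mathbb{T}^\infty)$ is taken with respect to $\mu_\infty$. Let $\mathbb{Z}_0^\infty$ (resp. $\mathbb{N}_0^\infty$) be the set of sequences $\alpha=(\alpha_1,\alpha_2,\ldots)$ of integers (resp. non-negative integers) with only finitely many non-zero components, and write $z^\alpha=\prod_j z_j^{\alpha_j}$. Every $f\in L^1(\mathbb{T}^\infty)$ has a Fourier series $f(z)=\sum_{\alpha\in\mathbb{Z}_0^\infty} c_\alpha z^\alpha$ with $c_\alpha=\int_{\mathbb{T}^\infty} f(z)\overline{z^\alpha}\,d\mu_\infty(z)$. The Riesz projection is $Pf(z)=\sum_{\alpha\in\mathbb{N}_0^\infty} c_\alpha z^\alpha$; it is well defined on $L^2(\mathbb{T}^\infty)$, hence on $L^\infty(\mathbb{T}^\infty)\subset L^2(\mathbb{T}^\infty)$, and is a contraction on $L^2(\mathbb{T}^\infty)$, so $p_\infty\ge 2$.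 The exponent $p_\infty$ is well defined: for $2\le p\le\infty$, $P$ is bounded from $L^\infty(\mathbb{T}^\infty)$ to $L^p(\mathbb{T}^\infty)$ (with norm $1$) if $p\leq p_\infty$, and unbounded if $p>p_\infty$. *)

theory Defs
  imports "HOL-Probability.Probability"
begin

text \<open>
  The infinite torus: sequences \<open>z :: nat \<Rightarrow> complex\<close> with \<open>\<bar>z j\<bar> = 1\<close> for all \<open>j\<close>. Coordinates are
  indexed from 0, so \<open>z\<^sub>1, z\<^sub>2, \<dots>\<close> are \<open>z 0, z 1, \<dots>\<close>.
\<close>

definition circle_measure :: "complex measure" where
  "circle_measure =
     distr (uniform_measure lborel {0..<2 * pi}) (restrict_space borel (sphere 0 1)) cis"

definition torus_measure :: "(nat \<Rightarrow> complex) measure" where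
  "torus_measure = (\<Pi>\<^sub>M j\<in>UNIV. circle_measure)"

definition Lp_norm :: "ereal \<Rightarrow> ((nat \<Rightarrow> complex) \<Rightarrow> complex) \<Rightarrow> real" where
  "Lp_norm p f =
     (if p = \<infinity> then real_of_ereal (esssup torus_measure (\<lambda>z. ereal (cmod (f z))))
      else (LINT z|torus_measure. cmod (f z) powr real_of_ereal p) powr (1 / real_of_ereal p))"

text \<open>
  Functions are not identified modulo null sets. The membership condition guarantees that the
  junk values of \<^const>\<open>Lp_norm\<close> (non-integrable functions, infinite essential supremum) play no
  role. Only exponents \<open>1 \<le> p \<le> \<infinity>\<close> are meaningful.
\<close>

definition Lp :: "ereal \<Rightarrow> ((nat \<Rightarrow> complex) \<Rightarrow> complex) set" where
  "Lp p = {f \<in> borel_measurable torus_measure.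
     if p = \<infinity> then esssup torus_measure (\<lambda>z. ereal (cmod (f z))) < \<infinity>
     else integrable torus_measure (\<lambda>z. cmod (f z) powr real_of_ereal p)}"

definition int_multiindices :: "(nat \<Rightarrow> int) set" where
  "int_multiindices = {\<alpha>. finite {j. \<alpha> j \<noteq> 0}}"

definition nonneg_multiindices :: "(nat \<Rightarrow> int) set" where
  "nonneg_multiindices = {\<alpha> \<in> int_multiindices. \<forall>j. 0 \<le> \<alpha> j}"

definition monomial :: "(nat \<Rightarrow> int) \<Rightarrow> (nat \<Rightarrow> complex) \<Rightarrow> complex" where
  "monomial \<alpha> z = (\<Prod>j | \<alpha> j \<noteq> 0. z j powi \<alpha> j)"

definition fourier_coeff :: "((nat \<Rightarrow> complex) \<Rightarrow> complex) \<Rightarrow> (nat \<Rightarrow> int) \<Rightarrow> complex" where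
  "fourier_coeff f \<alpha> = (LINT z|torus_measure. f z * cnj (monomial \<alpha> z))"

text \<open>
  The series \<open>\<Sum>\<alpha>\<in>nonneg_multiindices. c\<^sub>\<alpha> z\<^sup>\<alpha>\<close>, with unconditional convergence in \<open>L\<^sup>2\<close>. For
  \<open>f \<in> Lp 2\<close> such a sum \<open>g\<close> exists and is unique up to a null set; the choice operator picks a
  representative.
\<close>

definition riesz_projection ::
    "((nat \<Rightarrow> complex) \<Rightarrow> complex) \<Rightarrow> (nat \<Rightarrow> complex) \<Rightarrow> complex" where
  "riesz_projection f =
     (SOME g. g \<in> Lp 2 \<and>
        ((\<lambda>A. Lp_norm 2 (\<lambda>z. g z - (\<Sum>\<alpha>\<in>A. fourier_coeff f \<alpha> * monomial \<alpha> z))) \<longlongrightarrow> 0)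
          (finite_subsets_at_top nonneg_multiindices))"

definition riesz_bounded :: "ereal \<Rightarrow> bool" where
  "riesz_bounded p \<longleftrightarrow>
     (\<exists>C. \<forall>f\<in>Lp \<infinity>. riesz_projection f \<in> Lp p \<and>
        Lp_norm p (riesz_projection f) \<le> C * Lp_norm \<infinity> f)"

text \<open>
  The largest exponent for which the projection is bounded, with \<open>\<infinity>\<close> allowed. The supremum is
  used because it makes sense before one knows that the largest exponent exists; when it does,
  it is this value.
\<close>

definition p_infty :: ereal where
  "p_infty = Sup {p. 2 \<le> p \<and> riesz_bounded p}"

lemma p_infty_eq_largest:
  assumes "2 \<le> m" "riesz_bounded m" "\<And>p. 2 \<le> p \<Longrightarrow> riesz_bounded p \<Longrightarrow> p \<le> m"
  shows "p_infty = m" "(GREATEST p. 2 \<le> p \<and> riesz_bounded p) = m"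
proof -
  show "p_infty = m"
    unfolding p_infty_def by (rule Sup_eqI) (use assms in auto)
  show "(GREATEST p. 2 \<le> p \<and> riesz_bounded p) = m"
    by (rule Greatest_equality) (use assms in auto)
qed

lemma prob_space_circle_measure: "prob_space circle_measure"
proof -
  have "emeasure lborel {0..<2 * pi} = ennreal (2 * pi - 0)"
    by (rule emeasure_lborel_Ico) simp
  then have U: "prob_space (uniform_measure lborel {0..<2 * pi})"
    by (intro prob_space_uniform_measure) simp_all
  have "cis \<in> borel_measurable borel"
    by (intro borel_measurable_continuous_onI continuous_intros)
  then have "cis \<in> borel \<rightarrow>\<^sub>M restrict_space borel (sphere 0 1)"
    by (rule measurable_restrict_space2[rotated]) simp
  moreover have "sets (uniform_measure lborel {0..<2 * pi}) = sets borel"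
    by simp
  ultimately have "cis \<in> uniform_measure lborel {0..<2 * pi} \<rightarrow>\<^sub>M restrict_space borel (sphere 0 1)"
    using measurable_cong_sets by blast
  with U show ?thesis
    unfolding circle_measure_def by (rule prob_space.prob_space_distr)
qed

lemma prob_space_torus_measure: "prob_space torus_measure"
  unfolding torus_measure_def by (rule prob_space_PiM) (rule prob_space_circle_measure)

lemma space_torus_measure: "space torus_measure = {z. \<forall>j. cmod (z j) = 1}"
  by (auto simp: torus_measure_def circle_measure_def space_PiM space_restrict_space PiE_def Pi_def)

end

theory Submission
  imports Defs "HOL-Real_Asymp.Real_Asymp"
begin

text \<open>
  Let \<open>S = z\<^sub>1 + \<dots> + z\<^sub>n\<close> and \<open>f = S / \<bar>S\<bar>\<close>. The function \<open>f\<close> is homogeneous of degree one, so among the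
  exponents without negative entries only those of \<open>z\<^sub>1, \<dots>, z\<^sub>n\<close> contribute, and by symmetry
  \<open>P f = (E \<bar>S\<bar> / n) S\<close>. With \<open>U = S / sqrt n\<close> this gives \<open>\<parallel>P f\<parallel>\<^sub>q = E \<bar>U\<bar> \<cdot> (E \<bar>U\<bar>\<^sup>q)\<^bsup>1/q\<^esup>\<close>. By the central limit
  theorem \<open>U\<close> is asymptotically a standard complex Gaussian, so the lower limit of the right-hand side is
  at least \<open>(sqrt pi / 2) \<cdot> Gamma (1 + q/2)\<^bsup>1/q\<^esup>\<close>, which exceeds 1 exactly for \<open>q\<close> above the root. Since the norm of
  a product over disjoint blocks of variables is multiplicative, a norm above 1 can be amplified beyond
  any bound.

  The logarithmic form \<open>ln (Gamma (1 + p/2)) - p ln (2 / sqrt pi)\<close> of the equation is convex in \<open>p\<close> and vanishes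
  at 0, so two numerical values with opposite signs locate its unique positive root.
\<close>

section \<open>Two-sided bounds for the Gamma function\<close>

lemma ln_ratio_bounds:
  fixes u :: real
  assumes "0 < u" "u < 1"
  shows "2 * (u + u^3/3 + u^5/5) \<le> ln ((1+u)/(1-u))"
    and "ln ((1+u)/(1-u)) \<le> 2 * (u + u^3/3 + u^5 / (5 * (1 - u\<^sup>2)))"
proof -
  have y: "((1+u)/(1-u) - 1) / ((1+u)/(1-u) + 1) = u"
    using assms by (simp add: divide_simps)
  have gt: "(1+u)/(1-u) > 1" using assms by (simp add: divide_simps)
  show "2 * (u + u^3/3 + u^5/5) \<le> ln ((1+u)/(1-u))"
    using ln_approx_bounds[OF gt, of 3] unfolding y
    by (simp add: eval_nat_numeral algebra_simps)
  show "ln ((1+u)/(1-u)) \<le> 2 * (u + u^3/3 + u^5 / (5 * (1 - u\<^sup>2)))"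
    using ln_approx_bounds[OF gt, of 2] unfolding y
    by (simp add: eval_nat_numeral algebra_simps)
qed

text \<open>
  The terms of the Gauss product for \<open>ln (Gamma x)\<close>, with \<open>x * ln n\<close> replaced by
  \<open>x * ln (n + (1 + x) / 2)\<close>: this shift to the midpoint of \<open>n\<close> and \<open>n + 1 + x\<close> cancels the error of
  order \<open>1 / n\<close>, and the error that remains is \<open>x * (1 - x\<^sup>2) / 24\<close> over the square of the midpoint up to
  order four.
\<close>

definition ln_Gamma_approx :: "real \<Rightarrow> nat \<Rightarrow> real" where
  "ln_Gamma_approx x n = ln (fact n) + x * ln (real n + (1 + x) / 2) - (\<Sum>k\<le>n. ln (x + real k))"

lemma ln_Gamma_approx_LIMSEQ:
  assumes "0 < (x::real)"
  shows "ln_Gamma_approx x \<longlonglongrightarrow> ln (Gamma x)"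
proof -
  have eq: "ln_Gamma_approx x n = ln_Gamma_series x n + x * ln ((real n + (1+x)/2) / real n)" if "n > 0" for n
  proof -
    have 1: "(\<Sum>k\<le>n. ln (x + real k)) = ln x + (\<Sum>k=1..n. ln (x + real k))"
      by (simp add: sum.atMost_shift sum.atLeast1_atMost_eq lessThan_Suc_atMost)
    have 2: "(\<Sum>k=1..n. ln (x / real k + 1)) = (\<Sum>k=1..n. ln (x + real k)) - ln (fact n)"
    proof -
      have "ln (x / real k + 1) = ln (x + real k) - ln (real k)" if "k \<in> {1..n}" for k
      proof -
        have "x / real k + 1 = (x + real k) / real k" using that by (simp add: field_simps)
        then show ?thesis using that assms by (simp add: ln_div)
      qed
      moreover have "ln (fact n :: real) = (\<Sum>k=1..n. ln (real k))"
        unfolding fact_prod of_nat_prod by (subst ln_prod) auto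
      ultimately show ?thesis by (simp add: sum_subtractf)
    qed
    have 3: "ln ((real n + (1+x)/2) / real n) = ln (real n + (1+x)/2) - ln (real n)"
      using that assms by (intro ln_divide_pos add_nonneg_pos) auto
    show ?thesis
      unfolding ln_Gamma_approx_def ln_Gamma_series_def 1 2 3 by (simp add: algebra_simps)
  qed
  have "(\<lambda>n. x * ln ((real n + (1+x)/2) / real n)) \<longlonglongrightarrow> 0" by real_asymp
  then have "(\<lambda>n. ln_Gamma_series x n + x * ln ((real n + (1+x)/2) / real n)) \<longlonglongrightarrow> ln_Gamma x + 0"
    using assms by (intro tendsto_add ln_Gamma_real_LIMSEQ)
  moreover have "ln_Gamma x = ln (Gamma x)"
    using assms by (simp add: Gamma_real_pos_exp)
  ultimately have "(\<lambda>n. ln_Gamma_series x n + x * ln ((real n + (1+x)/2) / real n)) \<longlonglongrightarrow> ln (Gamma x)"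
    by simp
  then show ?thesis
    by (rule Lim_transform_eventually) (use eventually_gt_at_top[of 0] in eventually_elim, simp add: eq)
qed

lemma ln_Gamma_approx_Suc:
  fixes x :: real
  assumes "0 < x" "x < 1" and u: "u = 1 / (2 * real n + 2 + x)"
  shows "ln_Gamma_approx x (Suc n) - ln_Gamma_approx x n
         = x * ln ((1 + u) / (1 - u)) - ln ((1 + x * u) / (1 - x * u))"
proof -
  define d where "d = 2 * real n + 2 + x"
  have d: "d > 2" using assms by (simp add: d_def)
  have u: "u = 1 / d" by (simp add: u d_def)
  have 1: "ln ((1 + u) / (1 - u)) = ln (real (Suc n) + (1+x)/2) - ln (real n + (1+x)/2)"
  proof -
    have "(1 + u) / (1 - u) = (real (Suc n) + (1+x)/2) / (real n + (1+x)/2)"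
      using d by (simp add: u divide_simps) (simp add: d_def algebra_simps)
    moreover have "ln \<dots> = ln (real (Suc n) + (1+x)/2) - ln (real n + (1+x)/2)"
      using assms by (intro ln_divide_pos add_nonneg_pos) auto
    ultimately show ?thesis by simp
  qed
  have 2: "ln ((1 + x * u) / (1 - x * u)) = ln (x + real (Suc n)) - ln (real (Suc n))"
  proof -
    have "1 + x * u = (d + x) / d" "1 - x * u = (d - x) / d"
      using d by (simp_all add: u field_simps)
    moreover have "d + x = 2 * (x + real (Suc n))" "d - x = 2 * real (Suc n)"
      by (simp_all add: d_def)
    moreover have "(d + x) / d / ((d - x) / d) = (d + x) / (d - x)" using d by simp
    ultimately have "(1 + x * u) / (1 - x * u) = (x + real (Suc n)) / real (Suc n)"
      by (simp only: mult_divide_mult_cancel_left[OF zero_neq_numeral[symmetric]])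
    then show ?thesis using assms by (simp add: ln_div)
  qed
  have 3: "ln (fact (Suc n) :: real) = ln (real (Suc n)) + ln (fact n)"
    by (simp add: ln_mult)
  show ?thesis unfolding 1 2 unfolding ln_Gamma_approx_def 3 by (simp add: algebra_simps)
qed

lemma ln_Gamma_lower:
  fixes x :: real
  assumes x: "0 < x" "x < 4/5"
  shows "ln_Gamma_approx x n + x * (1 - x\<^sup>2) / 24 / ((real n + (1 + x) / 2)\<^sup>2 + 1/4) \<le> ln (Gamma x)"
proof -
  define l where "l = x * (1 - x\<^sup>2) / 24"
  define v where "v n = real n + (1 + x) / 2" for n
  define A where "A n = ln_Gamma_approx x n + l / ((v n)\<^sup>2 + 1/4)" for n
  have x2: "x\<^sup>2 \<le> 16/25" using x power_mono[of x "4/5" 2] by (simp add: power2_eq_square)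
  have l: "0 < l" using x x2 by (simp add: l_def)
  have "incseq A"
  proof (rule incseq_SucI)
    fix n
    define w where "w = real n + 1 + x / 2"
    define u where "u = 1 / (2 * real n + 2 + x)"
    have w: "w > 1" using x by (simp add: w_def)
    have uw: "u = 1 / (2 * w)" by (simp add: u_def w_def algebra_simps)
    have u: "0 < u" "u < 1/2" using w by (auto simp: uw field_simps)
    have xu: "0 < x * u" "x * u < 1" using u x mult_strict_mono[of x 1 u 1] by auto
    have up: "x * ln ((1 + u) / (1 - u)) \<ge> x * (2 * (u + u^3/3 + u^5/5))"
      using ln_ratio_bounds(1)[of u] u x by (intro mult_left_mono) auto
    have lo: "ln ((1 + x * u) / (1 - x * u)) \<le> 2 * (x*u + (x*u)^3/3 + (x*u)^5 / (5 * (1 - (x*u)\<^sup>2)))"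
      using ln_ratio_bounds(2)[of "x * u"] xu by auto
    have "(x*u)\<^sup>2 \<le> (4/5 * (1/2))\<^sup>2"
      using x u by (intro power_mono mult_mono) auto
    then have xu2: "(x*u)\<^sup>2 \<le> 4/25" by (simp add: power2_eq_square)
    have x4: "x^4 \<le> 1 - (x*u)\<^sup>2"
      using mult_mono[OF x2 x2] xu2 by (simp add: power2_eq_square power4_eq_xxxx)
    have "(x*u)^5 / (5 * (1 - (x*u)\<^sup>2)) = x * u^5 / 5 * (x^4 / (1 - (x*u)\<^sup>2))"
      by (simp add: power_mult_distrib eval_nat_numeral)
    also have "\<dots> \<le> x * u^5 / 5 * 1"
      using x u xu2 x4 by (intro mult_left_mono) (auto simp: divide_le_eq)
    finally have "ln ((1 + x * u) / (1 - x * u)) \<le> 2 * (x*u + (x*u)^3/3 + x * u^5 / 5)" using lo by simp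
    with up have "x * ln ((1 + u) / (1 - u)) - ln ((1 + x * u) / (1 - x * u)) \<ge>
      x * (2 * (u + u^3/3 + u^5/5)) - 2 * (x*u + (x*u)^3/3 + x * u^5 / 5)" by (intro diff_mono)
    also have "x * (2 * (u + u^3/3 + u^5/5)) - 2 * (x*u + (x*u)^3/3 + x * u^5 / 5) = 16 * l * u^3"
      by (simp add: l_def field_simps power_mult_distrib eval_nat_numeral)
    finally have phi: "16 * l * u^3 \<le> ln_Gamma_approx x (Suc n) - ln_Gamma_approx x n"
      using ln_Gamma_approx_Suc[of x u n] x by (simp add: u_def)
    have vw: "v n = w - 1/2" "v (Suc n) = w + 1/2" by (simp_all add: v_def w_def field_simps)
    have "l / ((v n)\<^sup>2 + 1/4) - l / ((v (Suc n))\<^sup>2 + 1/4) = l * (2 * w / (w^4 + 1/4))"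
    proof -
      have p: "(w - 1/2)\<^sup>2 + 1/4 > 0" "(w + 1/2)\<^sup>2 + 1/4 > 0" "w^4 + 1/4 > 0"
        by (auto intro!: add_nonneg_pos)
      have "((w - 1/2)\<^sup>2 + 1/4) * ((w + 1/2)\<^sup>2 + 1/4) = w^4 + 1/4"
        by (simp add: power2_eq_square power4_eq_xxxx algebra_simps)
      then have "1 / ((w - 1/2)\<^sup>2 + 1/4) - 1 / ((w + 1/2)\<^sup>2 + 1/4)
         = (((w + 1/2)\<^sup>2 + 1/4) - ((w - 1/2)\<^sup>2 + 1/4)) / (w^4 + 1/4)"
        using p by (subst diff_frac_eq) auto
      also have "((w + 1/2)\<^sup>2 + 1/4) - ((w - 1/2)\<^sup>2 + 1/4) = 2 * w"
        by (simp add: power2_eq_square algebra_simps)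
      finally have "l * (1 / ((w - 1/2)\<^sup>2 + 1/4) - 1 / ((w + 1/2)\<^sup>2 + 1/4)) = l * (2 * w / (w^4 + 1/4))"
        by simp
      then show ?thesis unfolding vw by (simp add: right_diff_distrib)
    qed
    also have "\<dots> \<le> l * (2 * w / w^4)"
      using l w by (intro mult_left_mono divide_left_mono mult_pos_pos add_pos_pos) auto
    also have "\<dots> = 16 * l * u^3"
      using w by (simp add: uw field_simps eval_nat_numeral)
    finally show "A n \<le> A (Suc n)" using phi by (simp add: A_def)
  qed
  moreover have "A \<longlonglongrightarrow> ln (Gamma x)"
  proof -
    have "(\<lambda>n. l / ((v n)\<^sup>2 + 1/4)) \<longlonglongrightarrow> 0" unfolding v_def by real_asymp
    from tendsto_add[OF ln_Gamma_approx_LIMSEQ[OF x(1)] this] show ?thesis by (simp add: A_def[abs_def])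
  qed
  ultimately have "A n \<le> ln (Gamma x)" by (rule incseq_le)
  then show ?thesis by (simp add: A_def l_def v_def)
qed

lemma ln_Gamma_upper:
  fixes x :: real
  assumes x: "0 < x" "x < 3/4"
  shows "ln (Gamma x) \<le> ln_Gamma_approx x n + x * (1 - x\<^sup>2) / 24 / (real n + (1 + x) / 2)\<^sup>2"
proof -
  define l where "l = x * (1 - x\<^sup>2) / 24"
  define v where "v n = real n + (1 + x) / 2" for n
  define A where "A n = ln_Gamma_approx x n + l / (v n)\<^sup>2" for n
  have x2: "x\<^sup>2 \<le> 9/16" using x power_mono[of x "3/4" 2] by (simp add: power2_eq_square)
  have l: "0 < l" using x x2 by (simp add: l_def)
  have "decseq A"
  proof (rule decseq_SucI)
    fix n
    define w where "w = real n + 1 + x / 2"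
    define u where "u = 1 / (2 * real n + 2 + x)"
    have w: "w > 1" using x by (simp add: w_def)
    have uw: "u = 1 / (2 * w)" by (simp add: u_def w_def algebra_simps)
    have u: "0 < u" "u < 1/2" using w by (auto simp: uw field_simps)
    have u2: "u\<^sup>2 \<le> 1/4" using power_mono[of u "1/2" 2] u by (simp add: power2_eq_square)
    have xu: "0 < x * u" "x * u < 1" using u x mult_strict_mono[of x 1 u 1] by auto
    have up: "x * ln ((1 + u) / (1 - u)) \<le> x * (2 * (u + u^3/3 + u^5/(5 * (1 - u\<^sup>2))))"
      using ln_ratio_bounds(2)[of u] u x by (intro mult_left_mono) auto
    have "2 * (x*u + (x*u)^3/3) \<le> 2 * (x*u + (x*u)^3/3 + (x*u)^5 / 5)"
      using xu by simp
    also have "\<dots> \<le> ln ((1 + x * u) / (1 - x * u))"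
      using ln_ratio_bounds(1)[of "x * u"] xu by auto
    finally have lo: "2 * (x*u + (x*u)^3/3) \<le> ln ((1 + x * u) / (1 - x * u))" .
    have "2 / (5 * (1 - u\<^sup>2)) \<le> 2/3 * (1 - x\<^sup>2) * 2"
    proof -
      have "2 / (5 * (1 - u\<^sup>2)) \<le> 2 / (5 * (3/4))" using u2 by (intro divide_left_mono) auto
      also have "\<dots> \<le> 2/3 * (1 - x\<^sup>2) * 2" using x2 by simp
      finally show ?thesis .
    qed
    then have "x * u^5 * (2 / (5 * (1 - u\<^sup>2))) \<le> x * u^5 * (2/3 * (1 - x\<^sup>2) * 2)"
      using x u by (intro mult_left_mono) auto
    moreover have "x * (2 * (u + u^3/3 + u^5/(5 * (1 - u\<^sup>2)))) = x * (2 * (u + u^3/3)) + x * u^5 * (2 / (5 * (1 - u\<^sup>2)))"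
      by (simp add: distrib_left)
    ultimately have "x * ln ((1 + u) / (1 - u)) \<le> x * (2 * (u + u^3/3)) + x * u^5 * (2/3 * (1 - x\<^sup>2) * 2)"
      using up by linarith
    from diff_mono[OF this lo] have "x * ln ((1 + u) / (1 - u)) - ln ((1 + x * u) / (1 - x * u)) \<le>
      x * (2 * (u + u^3/3)) + x * u^5 * (2/3 * (1 - x\<^sup>2) * 2) - 2 * (x*u + (x*u)^3/3)" .
    also have "\<dots> = 16 * l * u^3 * (1 + 2 * u\<^sup>2)"
      by (simp add: l_def field_simps power_mult_distrib eval_nat_numeral)
    also have "\<dots> \<le> 16 * l * u^3 * (1 / (1 - u\<^sup>2)\<^sup>2)"
    proof -
      have "(1 + 2 * u\<^sup>2) * (1 - u\<^sup>2)\<^sup>2 = 1 - u^4 * (3 - 2 * u\<^sup>2)"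
        by (simp add: algebra_simps eval_nat_numeral)
      also have "\<dots> \<le> 1" using u2 by simp
      finally have "(1 + 2 * u\<^sup>2) \<le> 1 / (1 - u\<^sup>2)\<^sup>2" using u2 by (simp add: pos_le_divide_eq)
      then show ?thesis using l u by (intro mult_left_mono) auto
    qed
    finally have phi: "ln_Gamma_approx x (Suc n) - ln_Gamma_approx x n \<le> 16 * l * u^3 / (1 - u\<^sup>2)\<^sup>2"
      using ln_Gamma_approx_Suc[of x u n] x by (simp add: u_def)
    have vw: "v n = w - 1/2" "v (Suc n) = w + 1/2" by (simp_all add: v_def w_def field_simps)
    have "l / (v n)\<^sup>2 - l / (v (Suc n))\<^sup>2 = l * (2 * w / (w\<^sup>2 - 1/4)\<^sup>2)"
    proof -
      have p: "(w - 1/2)\<^sup>2 > 0" "(w + 1/2)\<^sup>2 > 0" using w by auto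
      have e: "(w - 1/2)\<^sup>2 * (w + 1/2)\<^sup>2 = (w\<^sup>2 - 1/4)\<^sup>2"
        by (simp add: power2_eq_square algebra_simps)
      then have "1 / (w - 1/2)\<^sup>2 - 1 / (w + 1/2)\<^sup>2
         = ((w + 1/2)\<^sup>2 - (w - 1/2)\<^sup>2) / (w\<^sup>2 - 1/4)\<^sup>2"
        using p by (subst diff_frac_eq) auto
      also have "(w + 1/2)\<^sup>2 - (w - 1/2)\<^sup>2 = 2 * w"
        by (simp add: power2_eq_square algebra_simps)
      finally have "l * (1 / (w - 1/2)\<^sup>2 - 1 / (w + 1/2)\<^sup>2) = l * (2 * w / (w\<^sup>2 - 1/4)\<^sup>2)"
        by simp
      then show ?thesis unfolding vw by (simp add: right_diff_distrib)
    qed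
    also have "\<dots> = 16 * l * u^3 / (1 - u\<^sup>2)\<^sup>2"
    proof -
      have w2: "w\<^sup>2 - 1/4 > 0" using one_less_power[OF w, of 2] by linarith
      have e: "1 - u\<^sup>2 = (w\<^sup>2 - 1/4) / w\<^sup>2"
        using w by (simp add: uw diff_divide_distrib power_divide power_mult_distrib)
      have "2 * w / (w\<^sup>2 - 1/4)\<^sup>2 = 16 * u^3 / ((w\<^sup>2 - 1/4) / w\<^sup>2)\<^sup>2"
      proof -
        have "16 * (1 / (2 * w)) ^ 3 / (q / w\<^sup>2)\<^sup>2 = 2 * w / q\<^sup>2" if "q > 0" for q
          using w that by (simp add: field_simps eval_nat_numeral)
        from this[OF w2] show ?thesis by (simp add: uw)
      qed
      then show ?thesis unfolding e by simp
    qed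
    finally show "A (Suc n) \<le> A n" using phi by (simp add: A_def)
  qed
  moreover have "A \<longlonglongrightarrow> ln (Gamma x)"
  proof -
    have "(\<lambda>n. l / (v n)\<^sup>2) \<longlonglongrightarrow> 0" unfolding v_def by real_asymp
    from tendsto_add[OF ln_Gamma_approx_LIMSEQ[OF x(1)] this] show ?thesis by (simp add: A_def[abs_def])
  qed
  ultimately have "ln (Gamma x) \<le> A n" by (rule decseq_ge)
  then show ?thesis by (simp add: A_def l_def v_def)
qed

section \<open>The root of the equation\<close>

lemma ln_Gamma_approx_eq:
  assumes "0 < x"
  shows "ln_Gamma_approx x n = x * ln (real n + (1 + x) / 2) - ln ((\<Prod>k\<le>n. x + real k) / fact n)"
proof -
  have "(\<Prod>k\<le>n. x + real k) > 0" using assms by (intro prod_pos) (auto intro: add_pos_nonneg)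
  moreover have "ln (\<Prod>k\<le>n. x + real k) = (\<Sum>k\<le>n. ln (x + real k))"
    using assms by (intro ln_prod) (auto intro: add_pos_nonneg)
  ultimately show ?thesis by (simp add: ln_Gamma_approx_def ln_divide_pos)
qed

lemma ln_Gamma_two:
  assumes "0 < (x::real)"
  shows "ln (Gamma (x + 2)) = ln (x * (x + 1)) + ln (Gamma x)"
proof -
  have "Gamma (x + 2) = (x + 1) * (x * Gamma x)"
    using Gamma_plus1[of x] Gamma_plus1[of "x+1"] assms nonpos_Ints_nonpos[of x] nonpos_Ints_nonpos[of "x+1"]
    by (force simp: add.assoc)
  then show ?thesis using assms Gamma_real_pos[of x] by (simp add: ln_mult_pos mult.commute)
qed

definition Gamma_gap :: "real \<Rightarrow> real" where
  "Gamma_gap p = ln (Gamma (1 + p / 2)) - p * ln (2 / sqrt pi)"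

lemma Gamma_gap_eq:
  assumes "p > 2"
  shows "Gamma_gap p = ln ((p/2-1) * (p/2)) + ln (Gamma (p/2-1)) + p * (ln (Gamma (1/2)) - ln 2)"
  using ln_Gamma_two[of "p/2-1"] assms
  by (simp add: Gamma_gap_def Gamma_one_half_real ln_divide_pos algebra_simps)

lemma ln2_bounds: "0.693147180 < ln (2::real)" "ln (2::real) < 0.693147181"
  using ln_approx_bounds[of 2 9] by (simp_all add: eval_nat_numeral)

lemma ln_bounds5:
  fixes x :: real
  assumes "x > 1" "y = (x - 1) / (x + 1)"
  shows "2 * (y + y^3/3 + y^5/5 + y^7/7 + y^9/9) \<le> ln x"
    and "ln x \<le> 2 * (y + y^3/3 + y^5/5 + y^7/7 + y^9/9 + y^11 / (11 * (1 - y\<^sup>2)))"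
  using ln_approx_bounds[OF assms(1), of 5] unfolding assms(2)[symmetric]
  by (simp_all add: eval_nat_numeral algebra_simps)

lemma ln_decimal_lower:
  "0.204644353 < ln (1.2270885776::real)" "0.250797276 < ln (1.2850495481::real)"
  "0.263702130 < ln (1.30174039::real)" "0.259957524 < ln (1.296875::real)"
  by (rule less_le_trans[OF _ ln_bounds5(1)[OF _ refl]]; simp add: power_divide)+

lemma ln_decimal_upper:
  "ln (1.3017402344::real) < 0.263702012" "ln (1.296875::real) < 0.259957525"
  "ln (1.2271025373::real) < 0.204655730" "ln (1.2850495482::real) < 0.250797277"
  by (rule le_less_trans[OF ln_bounds5(2)[OF _ refl]]; simp add: power_divide)+

lemmas ln_decimal_bounds = ln_decimal_lower ln_decimal_upper

text \<open>
  As \<open>Gamma (1/2) = sqrt pi\<close>, no separate approximation of \<open>pi\<close> is needed.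
\<close>

lemma ln_Gamma_half_bounds:
  fixes c :: real
  assumes c_def: "c = 1/64"
  shows "ln (Gamma (1/2)) \<le> ln 2 - 0.250797276 + 0.259957525 / 2 + c / 20.75\<^sup>2" (is ?upper)
    and "ln 2 - 0.250797277 + 0.259957524 / 2 + c / (20.75\<^sup>2 + 1/4) \<le> ln (Gamma (1/2))" (is ?lower)
proof -
  define P :: real where "P = (\<Prod>k\<le>(20::nat). 1/2 + real k) / fact 20"
  have P: "2 * 1.2850495481 \<le> P" "P \<le> 2 * 1.2850495482"
    by (simp_all add: P_def atMost_nat_numeral fact_numeral)
  have "ln (2 * 1.2850495481) \<le> ln P" "ln P \<le> ln (2 * 1.2850495482)"
    using P by simp_all
  moreover have "ln (2 * 1.2850495481) = ln 2 + ln (1.2850495481::real)"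
    "ln (2 * 1.2850495482) = ln 2 + ln (1.2850495482::real)"
    by (rule ln_mult_pos; simp)+
  ultimately have P': "ln 2 + 0.250797276 \<le> ln P" "ln P \<le> ln 2 + 0.250797277"
    using ln_decimal_bounds by linarith+
  have "ln (real 20 + (1 + 1/2)/2) = ln (2^4 * 1.296875)" by simp
  also have "\<dots> = ln (2^4) + ln 1.296875" by (rule ln_mult_pos) auto
  also have "ln (2^4::real) = 4 * ln 2" by (subst ln_realpow) auto
  finally have v: "ln (real 20 + (1 + 1/2)/2) = 4 * ln 2 + ln 1.296875" .
  have a: "ln_Gamma_approx (1/2) 20 = 1/2 * (4 * ln 2 + ln 1.296875) - ln P"
    unfolding v[symmetric] P_def by (rule ln_Gamma_approx_eq) simp
  have *: "1/2 * (1 - (1/2)\<^sup>2) / 24 / (real 20 + (1 + 1/2)/2)\<^sup>2 = c / 20.75\<^sup>2"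
    "1/2 * (1 - (1/2)\<^sup>2) / 24 / ((real 20 + (1 + 1/2)/2)\<^sup>2 + 1/4) = c / (20.75\<^sup>2 + 1/4)"
    by (simp_all add: c_def power2_eq_square)
  have up: "G \<le> l - 0.250797276 + 0.259957525 / 2 + e"
    if "G \<le> 1/2 * (4 * l + s) - q + e" "l + 0.250797276 \<le> q" "s < 0.259957525" for G l s q e :: real
    using that by (simp add: field_simps)
  have "ln (Gamma (1/2)) \<le> 1/2 * (4 * ln 2 + ln 1.296875) - ln P + c / 20.75\<^sup>2"
    using ln_Gamma_upper[of "1/2" 20] unfolding a * by simp
  from up[OF this P'(1) ln_decimal_upper(2)] show ?upper .
  have lo: "l - 0.250797277 + 0.259957524 / 2 + e \<le> G"
    if "1/2 * (4 * l + s) - q + e \<le> G" "q \<le> l + 0.250797277" "0.259957524 < s" for G l s q e :: real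
    using that by (simp add: field_simps)
  have "1/2 * (4 * ln 2 + ln 1.296875) - ln P + c / (20.75\<^sup>2 + 1/4) \<le> ln (Gamma (1/2))"
    using ln_Gamma_lower[of "1/2" 20] unfolding a * by simp
  from lo[OF this P'(2) ln_decimal_lower(4)] show ?lower .
qed

text \<open>
  The value at \<open>3.311375\<close> is about \<open>-2.3e-7\<close>, so the errors must stay below that.
\<close>

lemma Gamma_gap_neg: "Gamma_gap 3.311375 < 0"
proof -
  define x :: real where "x = 10491/16000"
  define P :: real where "P = (\<Prod>k\<le>(20::nat). x + real k) / fact 20"
  have P: "(x * (x + 1)) * (4 * 1.2270885776) \<le> P"
    by (simp add: P_def x_def atMost_nat_numeral fact_numeral)
  have "ln ((x * (x + 1)) * (2^2 * 1.2270885776)) \<le> ln P"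
    using P by (simp add: x_def)
  also have "ln ((x * (x + 1)) * (2^2 * 1.2270885776)) = ln (x * (x + 1)) + (2 * ln 2 + ln 1.2270885776)"
    by (subst ln_mult_pos, simp add: x_def, simp, subst ln_mult_pos, simp, simp, subst ln_realpow, auto)
  finally have P': "ln (x * (x + 1)) + (2 * ln 2 + 0.204644353) \<le> ln P"
    using ln_decimal_bounds by linarith
  have "ln (real 20 + (1 + x)/2) \<le> ln (2^4 * 1.3017402344)" by (simp add: x_def)
  also have "\<dots> = ln (2^4) + ln 1.3017402344" by (rule ln_mult_pos) auto
  also have "ln (2^4::real) = 4 * ln 2" by (subst ln_realpow) auto
  finally have v: "ln (real 20 + (1 + x)/2) \<le> 4 * ln 2 + 0.263702012"
    using ln_decimal_bounds by linarith
  have a: "ln_Gamma_approx x 20 \<le> x * (4 * ln 2 + 0.263702012) - ln P"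
    using ln_Gamma_approx_eq[of x 20] mult_left_mono[OF v, of x]
    by (simp add: P_def) (simp add: x_def)
  have "ln (Gamma x) \<le> x * (4 * ln 2 + 0.263702012) - ln P + x * (1 - x\<^sup>2) / 24 / (20 + (1 + x) / 2)\<^sup>2"
    using ln_Gamma_upper[of x 20] a by (simp add: x_def)
  then have "ln (x * (x + 1)) + ln (Gamma x) \<le> x * (4 * ln 2 + 0.263702012) - (2 * ln 2 + 0.204644353) + x * (1 - x\<^sup>2) / 24 / (20 + (1 + x) / 2)\<^sup>2"
    using P' by linarith
  note S = this
  have gap: "Gamma_gap 3.311375 = ln (x * (x + 1)) + ln (Gamma x) + 3.311375 * (ln (Gamma (1/2)) - ln 2)"
    by (subst Gamma_gap_eq) (simp_all add: x_def mult.commute)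
  have arith: "S + 3.311375 * (G - l) < 0"
    if "S \<le> x * (4 * l + 0.263702012) - (2 * l + 0.204644353) + x * (1 - x\<^sup>2) / 24 / (20 + (1 + x) / 2)\<^sup>2"
      "G \<le> l - 0.250797276 + 0.259957525 / 2 + 1/64 / 20.75\<^sup>2" "l < 0.693147181" for S G l :: real
    using that unfolding x_def by (simp add: power2_eq_square field_simps)
  show ?thesis
    unfolding gap by (rule arith[OF S ln_Gamma_half_bounds(1)[OF refl] ln2_bounds(2)])
qed

lemma Gamma_gap_pos: "Gamma_gap 3.311385 > 0"
proof -
  define x :: real where "x = 262277/400000"
  define P :: real where "P = (\<Prod>k\<le>(20::nat). x + real k) / fact 20"
  have P: "P \<le> (x * (x + 1)) * (4 * 1.2271025373)" "P > 0"
    by (simp_all add: P_def x_def atMost_nat_numeral fact_numeral)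
  have "ln P \<le> ln ((x * (x + 1)) * (2^2 * 1.2271025373))"
    using P by (simp add: x_def)
  also have "ln ((x * (x + 1)) * (2^2 * 1.2271025373)) = ln (x * (x + 1)) + (2 * ln 2 + ln 1.2271025373)"
    by (subst ln_mult_pos, simp add: x_def, simp, subst ln_mult_pos, simp, simp, subst ln_realpow, auto)
  finally have P': "ln P \<le> ln (x * (x + 1)) + (2 * ln 2 + 0.204655730)"
    using ln_decimal_bounds by linarith
  have "ln (2^4 * 1.30174039) \<le> ln (real 20 + (1 + x)/2)" by (simp add: x_def)
  moreover have "ln (2^4 * 1.30174039) = ln (2^4) + ln (1.30174039::real)" by (rule ln_mult_pos) auto
  moreover have "ln (2^4::real) = 4 * ln 2" by (subst ln_realpow) auto
  ultimately have v: "4 * ln 2 + 0.263702130 \<le> ln (real 20 + (1 + x)/2)"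
    using ln_decimal_bounds by linarith
  have a: "x * (4 * ln 2 + 0.263702130) - ln P \<le> ln_Gamma_approx x 20"
    using ln_Gamma_approx_eq[of x 20] mult_left_mono[OF v, of x]
    by (simp add: P_def) (simp add: x_def)
  have "x * (4 * ln 2 + 0.263702130) - ln P + x * (1 - x\<^sup>2) / 24 / ((20 + (1 + x) / 2)\<^sup>2 + 1/4) \<le> ln (Gamma x)"
    using ln_Gamma_lower[of x 20] a by (simp add: x_def)
  then have "x * (4 * ln 2 + 0.263702130) - (2 * ln 2 + 0.204655730) + x * (1 - x\<^sup>2) / 24 / ((20 + (1 + x) / 2)\<^sup>2 + 1/4) \<le> ln (x * (x + 1)) + ln (Gamma x)"
    using P' by linarith
  note S = this
  have gap: "Gamma_gap 3.311385 = ln (x * (x + 1)) + ln (Gamma x) + 3.311385 * (ln (Gamma (1/2)) - ln 2)"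
    by (subst Gamma_gap_eq) (simp_all add: x_def mult.commute)
  have arith: "0 < S + 3.311385 * (G - l)"
    if "x * (4 * l + 0.263702130) - (2 * l + 0.204655730) + x * (1 - x\<^sup>2) / 24 / ((20 + (1 + x) / 2)\<^sup>2 + 1/4) \<le> S"
      "l - 0.250797277 + 0.259957524 / 2 + 1/64 / (20.75\<^sup>2 + 1/4) \<le> G" "0.693147180 < l" for S G l :: real
    using that unfolding x_def by (simp add: power2_eq_square field_simps)
  show ?thesis
    unfolding gap by (rule arith[OF S ln_Gamma_half_bounds(2)[OF refl] ln2_bounds(1)])
qed

lemma Gamma_gap_convex: "convex_on {-2<..} Gamma_gap"
proof (intro convex_onI)
  fix t x y :: real
  assume t: "0 < t" "t < 1" and xy: "x \<in> {-2<..}" "y \<in> {-2<..}"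
  have "ln (Gamma ((1 - t) * (1 + x/2) + t * (1 + y/2))) \<le> (1 - t) * ln (Gamma (1 + x/2)) + t * ln (Gamma (1 + y/2))"
    using convex_onD[OF log_convex_Gamma_real, of t "1 + x/2" "1 + y/2"] t xy by simp
  also have "(1 - t) * (1 + x/2) + t * (1 + y/2) = 1 + ((1 - t) * x + t * y) / 2"
    by (simp add: field_simps)
  finally show "Gamma_gap ((1 - t) *\<^sub>R x + t *\<^sub>R y) \<le> (1 - t) * Gamma_gap x + t * Gamma_gap y"
    by (simp add: Gamma_gap_def algebra_simps)
qed (simp add: convex_real_interval)

lemma Gamma_gap_cont: "continuous_on {0<..} Gamma_gap"
proof -
  have "continuous_on {0<..} (\<lambda>x::real. Gamma (1 + x / 2))"
  proof (rule continuous_on_compose2[OF continuous_on_Gamma])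
    show "{0<..} \<inter> \<int>\<^sub>\<le>\<^sub>0 = ({} :: real set)"
      using nonpos_Ints_nonpos by force
  qed (auto intro!: continuous_intros)
  then show ?thesis
    unfolding Gamma_gap_def
    using Gamma_real_pos by (intro continuous_intros) (force simp: less_le)+
qed

lemma Gamma_gap_0: "Gamma_gap 0 = 0"
  by (simp add: Gamma_gap_def)

lemma Gamma_gap_convexD:
  assumes "-2 < a" "a < b" "b < c"
  shows "(c - a) * Gamma_gap b \<le> (c - b) * Gamma_gap a + (b - a) * Gamma_gap c"
proof -
  define t where "t = (b - a) / (c - a)"
  have t: "0 \<le> t" "t \<le> 1" using assms by (auto simp: t_def)
  have b: "(1 - t) * a + t * c = b"
  proof -
    have "t * (c - a) = b - a" using assms by (simp add: t_def)
    then show ?thesis by (simp add: algebra_simps)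
  qed
  have "Gamma_gap b \<le> (1 - t) * Gamma_gap a + t * Gamma_gap c"
    using convex_onD[OF Gamma_gap_convex t, of a c] assms b by simp
  then have "(c - a) * Gamma_gap b \<le> (c - a) * ((1 - t) * Gamma_gap a + t * Gamma_gap c)"
    using assms by (intro mult_left_mono) auto
  also have "\<dots> = ((c - a) * (1 - t)) * Gamma_gap a + ((c - a) * t) * Gamma_gap c"
    by (simp add: algebra_simps)
  also have "(c - a) * t = b - a" using assms by (simp add: t_def)
  also have "(c - a) * (1 - t) = c - b" using assms by (simp add: t_def field_simps)
  finally show ?thesis .
qed

lemma Gamma_gap_root:
  obtains p where "3.311375 < p" "p < 3.311385" "Gamma_gap p = 0"
    "\<And>q. 0 < q \<Longrightarrow> Gamma_gap q = 0 \<Longrightarrow> q = p" "\<And>q. p < q \<Longrightarrow> 0 < Gamma_gap q"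
proof -
  have "\<exists>p\<ge>3.311375. p \<le> 3.311385 \<and> Gamma_gap p = 0"
    using Gamma_gap_neg Gamma_gap_pos
    by (intro IVT' continuous_on_subset[OF Gamma_gap_cont]) auto
  then obtain p where p: "3.311375 \<le> p" "p \<le> 3.311385" "Gamma_gap p = 0" by blast
  have "p \<noteq> 3.311375" "p \<noteq> 3.311385"
    using p(3) Gamma_gap_neg Gamma_gap_pos by fastforce+
  then have p': "3.311375 < p" "p < 3.311385"
    using p by linarith+
  have pos: "0 < Gamma_gap q" if "p < q" for q
  proof -
    have "0 \<le> (q - p) * Gamma_gap 3.311375 + (p - 3.311375) * Gamma_gap q"
      using Gamma_gap_convexD[of "3.311375" p q] p p' that by simp
    moreover have "(q - p) * Gamma_gap 3.311375 < 0"
      using that Gamma_gap_neg by (intro mult_pos_neg) auto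
    ultimately have "0 < (p - 3.311375) * Gamma_gap q" by linarith
    then show ?thesis using p' by (simp add: zero_less_mult_iff)
  qed
  have neg: "Gamma_gap q < 0" if "0 < q" "q < 3.311375" for q
  proof -
    have "3.311375 * Gamma_gap q \<le> q * Gamma_gap 3.311375"
      using Gamma_gap_convexD[of 0 q "3.311375"] that by (simp add: Gamma_gap_0)
    also have "\<dots> < 0" using that Gamma_gap_neg by (intro mult_pos_neg) auto
    finally show ?thesis by simp
  qed
  have mid: "Gamma_gap q < 0" if "3.311375 \<le> q" "q < p" for q
  proof (cases "q = 3.311375")
    case True
    show ?thesis unfolding True by (rule Gamma_gap_neg)
  next
    case False
    then have "(p - 3.311375) * Gamma_gap q \<le> (p - q) * Gamma_gap 3.311375"
      using Gamma_gap_convexD[of "3.311375" q p] that p by simp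
    also have "\<dots> < 0" using that Gamma_gap_neg by (intro mult_pos_neg) auto
    finally show ?thesis using p' by (simp add: mult_less_0_iff)
  qed
  have "q = p" if "0 < q" "Gamma_gap q = 0" for q
  proof (rule ccontr)
    assume "q \<noteq> p"
    then consider "q < 3.311375" | "3.311375 \<le> q" "q < p" | "p < q" by linarith
    then show False
      using pos neg mid that by cases force+
  qed
  then show ?thesis using that p p' pos by blast
qed

lemma Gamma_gap_root_iff:
  assumes "0 < q"
  shows "Gamma (1 + q / 2) powr (1 / q) = 2 / sqrt pi \<longleftrightarrow> Gamma_gap q = 0"
proof -
  have G: "Gamma (1 + q/2) > 0" using assms by (intro Gamma_real_pos) auto
  have "Gamma (1 + q / 2) powr (1 / q) = 2 / sqrt pi \<longleftrightarrow> ln (Gamma (1 + q / 2) powr (1 / q)) = ln (2 / sqrt pi)"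
    using G by (subst ln_inj_iff) auto
  also have "\<dots> \<longleftrightarrow> Gamma_gap q = 0"
    using assms G by (simp add: ln_powr Gamma_gap_def field_simps)
  finally show ?thesis .
qed

section \<open>Moments of the normal distribution and of the circle\<close>

lemma has_integral_powr_exp_square:
  fixes r :: real
  assumes r: "0 < r"
  shows "((\<lambda>x. x powr r * exp (- x\<^sup>2 / 2)) has_integral 2 powr ((r - 1) / 2) * Gamma ((r + 1) / 2)) {0<..}"
proof -
  define s where "s = (r + 1) / 2"
  define g where "g = (\<lambda>x::real. x\<^sup>2 / 2)"
  define f where "f = (\<lambda>t::real. t powr (s - 1) / exp t)"
  have img: "g ` {0<..} = {0<..}"
  proof (intro equalityI subsetI)
    fix y :: real assume "y \<in> {0<..}"
    then have "y = g (sqrt (2 * y))" "sqrt (2 * y) \<in> {0<..}" by (auto simp: g_def)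
    then show "y \<in> g ` {0<..}" by blast
  qed (auto simp: g_def)
  have "inj_on g {0<..}" by (auto simp: inj_on_def g_def power2_eq_iff)
  moreover have "(g has_field_derivative x) (at x within {0<..})" for x
    unfolding g_def by (auto intro!: derivative_eq_intros)
  ultimately have cv: "(\<lambda>x. \<bar>x\<bar> * f (g x)) absolutely_integrable_on {0<..} \<and>
      integral {0<..} (\<lambda>x. \<bar>x\<bar> * f (g x)) = b \<longleftrightarrow> f absolutely_integrable_on (g ` {0<..}) \<and> integral (g ` {0<..}) f = b" for b
    by (intro has_absolute_integral_change_of_variables_1') auto
  have "(f has_integral Gamma s) {0..}"
    unfolding f_def using r by (intro Gamma_integral_real) (auto simp: s_def)
  then have f: "(f has_integral Gamma s) {0<..}"
    by (rule has_integral_spike_set_eq[THEN iffD1, rotated -1])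
       (auto intro: negligible_subset[of "{0}"])
  then have "f absolutely_integrable_on {0<..}"
    by (intro nonnegative_absolutely_integrable_1) (auto simp: f_def has_integral_integrable)
  then have "f absolutely_integrable_on g ` {0<..} \<and> integral (g ` {0<..}) f = Gamma s"
    unfolding img using integral_unique[OF f] by (rule conjI)
  then have "(\<lambda>x. \<bar>x\<bar> * f (g x)) absolutely_integrable_on {0<..} \<and>
      integral {0<..} (\<lambda>x. \<bar>x\<bar> * f (g x)) = Gamma s"
    by (rule iffD2[OF cv])
  then have "((\<lambda>x. \<bar>x\<bar> * f (g x)) has_integral Gamma s) {0<..}"
    unfolding has_integral_iff absolutely_integrable_on_def by blast
  from has_integral_mult_right[OF this, of "2 powr ((r - 1) / 2)"]
  have "((\<lambda>x. 2 powr ((r - 1) / 2) * (\<bar>x\<bar> * f (g x))) has_integral 2 powr ((r - 1) / 2) * Gamma s) {0<..}"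
    by simp
  then show ?thesis
    unfolding s_def[symmetric]
  proof (rule has_integral_eq[rotated])
    fix x :: real assume "x \<in> {0<..}"
    then have x: "0 < x" by simp
    have s: "s - 1 = (r - 1) / 2" by (simp add: s_def field_simps)
    have "(x\<^sup>2) powr ((r - 1) / 2) = x powr (2 * ((r - 1) / 2))"
      using x by (simp only: powr_powr flip: powr_numeral)
    also have "2 * ((r - 1) / 2) = r - 1" by simp
    finally have "f (g x) = x powr (r - 1) / 2 powr ((r - 1) / 2) / exp (x\<^sup>2 / 2)"
      unfolding f_def g_def s by (simp add: powr_divide)
    moreover have "x * x powr (r - 1) = x powr r"
      using x by (simp add: powr_diff)
    ultimately show "2 powr ((r - 1) / 2) * (\<bar>x\<bar> * f (g x)) = x powr r * exp (- x\<^sup>2 / 2)"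
      using x by (simp add: exp_minus field_simps)
  qed
qed

lemma std_normal_abs_moment:
  fixes r :: real
  assumes r: "0 < r"
  shows "(\<integral>\<^sup>+x. ennreal (\<bar>x\<bar> powr r) \<partial>std_normal_distribution)
         = ennreal (2 powr (r / 2) * Gamma ((r + 1) / 2) / sqrt pi)"
proof -
  define I where "I = 2 powr ((r - 1) / 2) * Gamma ((r + 1) / 2)"
  define f where "f = (\<lambda>x. ennreal (\<bar>x\<bar> powr r * exp (- x\<^sup>2 / 2)))"
  have I0: "I \<ge> 0" using r by (simp add: I_def Gamma_real_nonneg)
  have f[measurable]: "f \<in> borel_measurable borel" by (simp add: f_def)
  have pos: "(\<integral>\<^sup>+x. f x * indicator {0<..} x \<partial>lborel) = ennreal I"
  proof -
    have "(\<integral>\<^sup>+x. ennreal (x powr r * exp (- x\<^sup>2 / 2)) * indicator {0<..} x \<partial>lborel) = ennreal I"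
      unfolding I_def by (rule nn_integral_has_integral_lebesgue'[OF _ has_integral_powr_exp_square[OF r]]) auto
    moreover have "(\<integral>\<^sup>+x. f x * indicator {0<..} x \<partial>lborel) = (\<integral>\<^sup>+x. ennreal (x powr r * exp (- x\<^sup>2 / 2)) * indicator {0<..} x \<partial>lborel)"
      by (intro nn_integral_cong) (auto simp: f_def indicator_def)
    ultimately show ?thesis by simp
  qed
  have neg: "(\<integral>\<^sup>+x. f x * indicator {..<0} x \<partial>lborel) = ennreal I"
  proof -
    have "(\<integral>\<^sup>+x. f x * indicator {..<0} x \<partial>lborel) = (\<integral>\<^sup>+x. f (0 + -1 * x) * indicator {..<0} (0 + -1 * x) \<partial>lborel)"
      by (subst nn_integral_real_affine[of _ "-1" 0]) auto
    also have "\<dots> = (\<integral>\<^sup>+x. f x * indicator {0<..} x \<partial>lborel)"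
      by (intro nn_integral_cong) (auto simp: f_def indicator_def)
    finally show ?thesis using pos by simp
  qed
  have "(\<integral>\<^sup>+x. f x \<partial>lborel) = (\<integral>\<^sup>+x. f x * indicator {0<..} x + f x * indicator {..<0} x \<partial>lborel)"
    by (intro nn_integral_cong) (auto simp: f_def indicator_def)
  also have "\<dots> = ennreal (2 * I)"
    by (subst nn_integral_add) (auto simp: pos neg I0 simp flip: ennreal_plus)
  finally have fI: "(\<integral>\<^sup>+x. f x \<partial>lborel) = ennreal (2 * I)" .
  have "(\<integral>\<^sup>+x. ennreal (\<bar>x\<bar> powr r) \<partial>std_normal_distribution)
      = (\<integral>\<^sup>+x. ennreal (1 / sqrt (2 * pi)) * f x \<partial>lborel)"
    by (subst nn_integral_density)
       (auto intro!: nn_integral_cong simp: f_def std_normal_density_def mult_ac simp flip: ennreal_mult)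
  also have "\<dots> = ennreal (1 / sqrt (2 * pi)) * ennreal (2 * I)"
    by (subst nn_integral_cmult) (auto simp: fI)
  also have "\<dots> = ennreal (1 / sqrt (2 * pi) * (2 * I))"
    using I0 by (subst ennreal_mult) auto
  also have "1 / sqrt (2 * pi) * (2 * I) = 2 powr (r / 2) * Gamma ((r + 1) / 2) / sqrt pi"
  proof -
    have "(2::real) powr (r / 2) = 2 powr (1/2 + (r - 1) / 2)" by (simp add: field_simps)
    also have "\<dots> = sqrt 2 * 2 powr ((r - 1) / 2)" by (simp only: powr_add powr_half_sqrt)
    also have "sqrt 2 = 2 / sqrt 2" by (simp add: real_div_sqrt)
    finally have "2 / sqrt 2 * 2 powr ((r - 1) / 2) = (2::real) powr (r / 2)" ..
    then show ?thesis by (simp add: I_def real_sqrt_mult field_simps)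
  qed
  finally show ?thesis .
qed

lemma has_integral_cos_powr:
  fixes r :: real
  assumes r: "0 < r"
  shows "((\<lambda>t. cos t powr r) has_integral Beta (1/2) ((r + 1) / 2) / 2) {0<..<pi/2}"
proof -
  define g where "g = (\<lambda>t::real. (sin t)\<^sup>2)"
  define f where "f = (\<lambda>t::real. t powr (1/2 - 1) * (1 - t) powr ((r + 1) / 2 - 1))"
  define B where "B = Beta (1/2) ((r + 1) / 2)"
  have img: "g ` {0<..<pi/2} = {0<..<1}"
  proof (intro equalityI subsetI)
    fix y :: real assume y: "y \<in> {0<..<1}"
    then have s: "0 < sqrt y" "sqrt y < 1" by auto
    have a: "0 < arcsin (sqrt y)" "arcsin (sqrt y) < pi/2"
      using arcsin_less_mono[of 0 "sqrt y"] arcsin_lt_bounded[of "sqrt y"] s by auto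
    have "sin (arcsin (sqrt y)) = sqrt y" using y by (intro sin_arcsin) (auto intro: order_trans[of _ 0])
    then have "g (arcsin (sqrt y)) = y" using y by (simp add: g_def)
    with a show "y \<in> g ` {0<..<pi/2}" by (metis greaterThanLessThan_iff imageI)
  next
    fix y assume "y \<in> g ` {0<..<pi/2}"
    then obtain t where t: "0 < t" "t < pi/2" "y = (sin t)\<^sup>2" by (auto simp: g_def)
    have "0 < sin t" "sin t < 1"
      using t sin_gt_zero[of t] sin_monotone_2pi[of t "pi/2"] by auto
    then show "y \<in> {0<..<1}" using t by (simp add: power_less_one_iff)
  qed
  have inj: "inj_on g {0<..<pi/2}"
  proof (rule inj_onI)
    fix s t assume st: "s \<in> {0<..<pi/2}" "t \<in> {0<..<pi/2}" "g s = g t"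
    have "0 < sin s" "0 < sin t" using st by (auto intro!: sin_gt_zero)
    then have "sin s = sin t" using st by (simp add: g_def power2_eq_iff)
    moreover have "- (pi/2) \<le> s" "s \<le> pi/2" "- (pi/2) \<le> t" "t \<le> pi/2"
      using st(1,2) pi_gt_zero unfolding greaterThanLessThan_iff by linarith+
    ultimately show "s = t" by (rule sin_inj_pi[rotated 4])
  qed
  have der: "(g has_field_derivative (2 * sin t * cos t)) (at t within {0<..<pi/2})" for t
    unfolding g_def by (auto intro!: derivative_eq_intros)
  have cv: "(\<lambda>x. \<bar>2 * sin x * cos x\<bar> * f (g x)) absolutely_integrable_on {0<..<pi/2} \<and>
      integral {0<..<pi/2} (\<lambda>x. \<bar>2 * sin x * cos x\<bar> * f (g x)) = b \<longleftrightarrow>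
      f absolutely_integrable_on (g ` {0<..<pi/2}) \<and> integral (g ` {0<..<pi/2}) f = b" for b
    by (intro has_absolute_integral_change_of_variables_1' der inj) auto
  have "(f has_integral B) {0..1}"
    unfolding f_def B_def using r by (intro has_integral_Beta_real) auto
  then have f: "(f has_integral B) {0<..<1}"
    by (simp add: has_integral_Icc_iff_Ioo)
  then have "f absolutely_integrable_on {0<..<1}"
    by (intro nonnegative_absolutely_integrable_1) (auto simp: f_def has_integral_integrable)
  then have "f absolutely_integrable_on g ` {0<..<pi/2} \<and> integral (g ` {0<..<pi/2}) f = B"
    unfolding img using integral_unique[OF f] by (rule conjI)
  then have "(\<lambda>x. \<bar>2 * sin x * cos x\<bar> * f (g x)) absolutely_integrable_on {0<..<pi/2} \<and>
      integral {0<..<pi/2} (\<lambda>x. \<bar>2 * sin x * cos x\<bar> * f (g x)) = B"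
    by (rule iffD2[OF cv])
  then have "((\<lambda>x. \<bar>2 * sin x * cos x\<bar> * f (g x)) has_integral B) {0<..<pi/2}"
    unfolding has_integral_iff absolutely_integrable_on_def by blast
  from has_integral_mult_right[OF this, of "1/2"]
  have "((\<lambda>x. 1/2 * (\<bar>2 * sin x * cos x\<bar> * f (g x))) has_integral B / 2) {0<..<pi/2}"
    by simp
  then show ?thesis unfolding B_def[symmetric]
  proof (rule has_integral_eq[rotated])
    fix t :: real assume t: "t \<in> {0<..<pi/2}"
    have s: "0 < sin t" using t by (auto intro!: sin_gt_zero)
    have c: "0 < cos t" using t by (auto intro!: cos_gt_zero)
    have "g t powr (1/2 - 1) = 1 / sin t"
      using s by (simp add: g_def powr_minus_divide powr_half_sqrt)
    moreover have "1 - g t = (cos t)\<^sup>2" by (simp add: g_def cos_squared_eq)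
    moreover have "(cos t)\<^sup>2 powr ((r + 1) / 2 - 1) = cos t powr (r - 1)"
    proof -
      have "(cos t)\<^sup>2 powr ((r + 1) / 2 - 1) = cos t powr (2 * ((r + 1) / 2 - 1))"
        using c by (simp only: powr_powr flip: powr_numeral)
      also have "2 * ((r + 1) / 2 - 1) = r - 1" by (simp add: field_simps)
      finally show ?thesis .
    qed
    ultimately have "f (g t) = cos t powr (r - 1) / sin t" by (simp add: f_def)
    moreover have "cos t * cos t powr (r - 1) = cos t powr r" using c by (simp add: powr_diff)
    ultimately show "1/2 * (\<bar>2 * sin t * cos t\<bar> * f (g t)) = cos t powr r"
      using s c by (simp add: abs_mult)
  qed
qed

lemma has_integral_abs_cos_powr:
  fixes r :: real
  assumes r: "0 < r"
  shows "((\<lambda>t. \<bar>cos t\<bar> powr r) has_integral 2 * Beta (1/2) ((r + 1) / 2)) {0..2 * pi}"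
proof -
  define J where "J = Beta (1/2) ((r + 1) / 2) / 2"
  define f where "f = (\<lambda>t. \<bar>cos t\<bar> powr r)"
  have "(f has_integral J) {0<..<pi/2}"
    by (rule has_integral_eq[OF _ has_integral_cos_powr[OF r, folded J_def]])
       (auto simp: f_def intro!: abs_of_pos[symmetric] cos_gt_zero arg_cong2[where f="(powr)"])
  then have 1: "(f has_integral J) {0..pi/2}" by (simp add: has_integral_Icc_iff_Ioo)
  have "((\<lambda>x. f (-1 *\<^sub>R x + pi)) has_integral J) ((\<lambda>x. (1 / -1) *\<^sub>R x + - ((1 / -1) *\<^sub>R pi)) ` cbox 0 (pi/2))"
    using has_integral_affinity[of f J 0 "pi/2" "-1" pi] 1 by simp
  moreover have "(\<lambda>x. (1 / -1) *\<^sub>R x + - ((1 / -1) *\<^sub>R pi)) ` cbox 0 (pi/2) = {pi/2..pi}"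
    using image_affinity_atLeastAtMost[of "-1" pi 0 "pi/2"] by simp
  moreover have "(\<lambda>x. f (-1 *\<^sub>R x + pi)) = f" by (auto simp: f_def cos_diff fun_eq_iff)
  ultimately have "(f has_integral J) {pi/2..pi}" by simp
  from has_integral_combine[OF _ _ 1 this] have 2: "(f has_integral 2 * J) {0..pi}" by simp
  have "((\<lambda>x. f (1 *\<^sub>R x + - pi)) has_integral 2 * J) (cbox pi (2 * pi))"
    using has_integral_affinity'[of f "2 * J" 0 pi 1 "-pi"] 2 by simp
  moreover have "(\<lambda>x. f (1 *\<^sub>R x + - pi)) = f" by (auto simp: f_def cos_diff fun_eq_iff)
  ultimately have "(f has_integral 2 * J) {pi..2 * pi}" by simp
  from has_integral_combine[OF _ _ 2 this] have "(f has_integral 4 * J) {0..2 * pi}" by simp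
  then show ?thesis by (simp add: f_def J_def)
qed

lemma nn_integral_circle_measure:
  assumes [measurable]: "f \<in> borel_measurable borel"
  shows "(\<integral>\<^sup>+w. f w \<partial>circle_measure) = (\<integral>\<^sup>+t. f (cis t) * indicator {0..<2*pi} t \<partial>lborel) / ennreal (2 * pi)"
proof -
  have [measurable]: "cis \<in> borel_measurable borel"
    by (intro borel_measurable_continuous_onI continuous_intros)
  have m: "cis \<in> uniform_measure lborel {0..<2 * pi} \<rightarrow>\<^sub>M restrict_space borel (sphere 0 1)"
    by (rule measurable_restrict_space2) auto
  have "(\<integral>\<^sup>+w. f w \<partial>circle_measure) = (\<integral>\<^sup>+t. f (cis t) \<partial>uniform_measure lborel {0..<2 * pi})"
    unfolding circle_measure_def
    by (rule nn_integral_distr[OF m]) (auto intro: measurable_restrict_space1)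
  also have "\<dots> = (\<integral>\<^sup>+t. f (cis t) * indicator {0..<2*pi} t \<partial>lborel) / emeasure lborel {0..<2*pi}"
    by (rule nn_integral_uniform_measure) auto
  also have "emeasure lborel {0..<2*pi} = ennreal (2 * pi)"
    by (subst emeasure_lborel_Ico) auto
  finally show ?thesis .
qed

lemma circle_abs_Re_moment:
  fixes r :: real
  assumes r: "0 < r"
  shows "(\<integral>\<^sup>+w. ennreal (\<bar>Re w\<bar> powr r) \<partial>circle_measure)
         = ennreal (Gamma ((r + 1) / 2) / (sqrt pi * Gamma (1 + r / 2)))"
proof -
  have "(\<integral>\<^sup>+t. ennreal (\<bar>cos t\<bar> powr r) * indicator {0..<2*pi} t \<partial>lborel)
      = (\<integral>\<^sup>+t. ennreal (\<bar>cos t\<bar> powr r) * indicator {0..2*pi} t \<partial>lborel)"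
    by (intro nn_integral_cong_AE, use AE_lborel_singleton[of "2*pi"] in eventually_elim)
       (auto simp: indicator_def)
  also have "\<dots> = ennreal (2 * Beta (1/2) ((r + 1) / 2))"
    by (rule nn_integral_has_integral_lebesgue'[OF _ has_integral_abs_cos_powr[OF r]]) auto
  finally have "(\<integral>\<^sup>+w. ennreal (\<bar>Re w\<bar> powr r) \<partial>circle_measure)
      = ennreal (2 * Beta (1/2) ((r + 1) / 2)) / ennreal (2 * pi)"
    by (subst nn_integral_circle_measure) simp_all
  also have "\<dots> = ennreal (Beta (1/2) ((r + 1) / 2) / pi)"
  proof (rule trans[OF divide_ennreal])
    have "0 \<le> Gamma (1/2 :: real)" "0 \<le> Gamma ((r + 1) / 2)" "0 \<le> Gamma (1/2 + (r + 1) / 2)"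
      using r by (auto intro!: less_imp_le[OF Gamma_real_pos] add_pos_pos)
    then show "0 \<le> 2 * Beta (1/2) ((r + 1) / 2)" unfolding Beta_def by simp
  qed auto
  finally have 1: "(\<integral>\<^sup>+w. ennreal (\<bar>Re w\<bar> powr r) \<partial>circle_measure) = ennreal (Beta (1/2) ((r + 1) / 2) / pi)" .
  have "1/2 + (r + 1) / 2 = 1 + r/2" by (simp add: field_simps)
  then have "Beta (1/2) ((r + 1) / 2) / pi = (sqrt pi / pi) * (Gamma ((r + 1) / 2) / Gamma (1 + r / 2))"
    by (simp add: Beta_def Gamma_one_half_real)
  also have "sqrt pi / pi = 1 / sqrt pi"
    by (simp add: sqrt_divide_self_eq inverse_eq_divide)
  also have "1 / sqrt pi * (Gamma ((r + 1) / 2) / Gamma (1 + r / 2)) = Gamma ((r + 1) / 2) / (sqrt pi * Gamma (1 + r / 2))"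
    by simp
  finally show ?thesis unfolding 1 by simp
qed

section \<open>Symmetries and independence on the torus\<close>

interpretation torus: prob_space torus_measure by (rule prob_space_torus_measure)
interpretation circle: prob_space circle_measure by (rule prob_space_circle_measure)

lemma sets_circle_measure: "sets circle_measure = sets (restrict_space borel (sphere 0 1))"
  by (simp add: circle_measure_def)

lemma space_circle_measure: "space circle_measure = sphere 0 1"
  by (simp add: circle_measure_def space_restrict_space)

lemma measurable_circle_id: "(\<lambda>w. w) \<in> borel_measurable circle_measure"
  by (subst measurable_cong_sets[OF sets_circle_measure refl]) (auto intro: measurable_restrict_space1)

lemma measurable_into_circle:
  assumes "f \<in> borel_measurable M" "\<And>x. x \<in> space M \<Longrightarrow> cmod (f x) = 1"
  shows "f \<in> M \<rightarrow>\<^sub>M circle_measure"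
  by (subst measurable_cong_sets[OF refl sets_circle_measure])
     (use assms in \<open>auto intro!: measurable_restrict_space2\<close>)

lemma measurable_torus_coord_circle: "(\<lambda>z. z k) \<in> torus_measure \<rightarrow>\<^sub>M circle_measure"
  unfolding torus_measure_def by measurable

lemma measurable_torus_coord [measurable]: "(\<lambda>z. z k) \<in> borel_measurable torus_measure"
  using measurable_compose[OF measurable_torus_coord_circle measurable_circle_id] .

lemma measurable_into_torus:
  assumes "\<And>k. (\<lambda>x. f x k) \<in> borel_measurable M" "\<And>x k. x \<in> space M \<Longrightarrow> cmod (f x k) = 1"
  shows "f \<in> M \<rightarrow>\<^sub>M torus_measure"
  unfolding torus_measure_def
  by (rule measurable_PiM_single')
     (use assms in \<open>auto intro!: measurable_into_circle simp: space_circle_measure\<close>)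

lemma distr_torus_coord: "distr torus_measure circle_measure (\<lambda>z. z k) = circle_measure"
  unfolding torus_measure_def
  by (rule distr_PiM_component) (auto simp: prob_space_circle_measure)

lemma indep_vars_torus_coords: "torus.indep_vars (\<lambda>_. circle_measure) (\<lambda>k z. z k) UNIV"
  by (subst torus.indep_vars_iff_distr_eq_PiM)
     (simp_all add: measurable_torus_coord_circle distr_torus_coord, simp add: torus_measure_def restrict_def)

lemma distr_torus_reindex:
  assumes "inj \<sigma>"
  shows "distr torus_measure torus_measure (\<lambda>z k. z (\<sigma> k)) = torus_measure"
  using distr_PiM_reindex[of UNIV "\<lambda>_. circle_measure" \<sigma> UNIV] assms
  by (simp add: prob_space_circle_measure torus_measure_def restrict_def)

lemma measurable_torus_reindex: "(\<lambda>z k. z (\<sigma> k)) \<in> torus_measure \<rightarrow>\<^sub>M torus_measure"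
  by (rule measurable_into_torus) (auto simp: space_torus_measure)

lemma nn_integral_circle_rotate:
  assumes [measurable]: "f \<in> borel_measurable borel" and w: "cmod w = 1"
  shows "(\<integral>\<^sup>+z. f (w * z) \<partial>circle_measure) = (\<integral>\<^sup>+z. f z \<partial>circle_measure)"
proof -
  define a where "a = Arg2pi w"
  have "w = exp (\<i> * of_real a)" using Arg2pi[of w] w by (simp add: a_def is_Arg_def)
  then have a: "0 \<le> a" "a < 2 * pi" "w = cis a"
    using Arg2pi[of w] by (simp_all add: a_def cis_conv_exp)
  define G where "G = (\<lambda>t. f (cis t))"
  have [measurable]: "cis \<in> borel_measurable borel"
    by (intro borel_measurable_continuous_onI continuous_intros)
  have [measurable]: "G \<in> borel_measurable borel"
    unfolding G_def by (rule measurable_compose[OF _ assms(1)]) fact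
  have per: "G (2 * pi + t) = G t" for t by (simp add: G_def cis_mult[symmetric])
  have "(\<integral>\<^sup>+t. G (a + t) * indicator {0..<2*pi} t \<partial>lborel) = (\<integral>\<^sup>+t. G t * indicator {a..<2*pi + a} t \<partial>lborel)"
    by (subst (2) nn_integral_real_affine[of _ 1 a])
       (auto intro!: nn_integral_cong simp: indicator_def)
  also have "\<dots> = (\<integral>\<^sup>+t. G t * indicator {a..<2*pi} t + G t * indicator {2*pi..<2*pi+a} t \<partial>lborel)"
    using a by (intro nn_integral_cong) (auto simp: indicator_def)
  also have "\<dots> = (\<integral>\<^sup>+t. G t * indicator {a..<2*pi} t \<partial>lborel) + (\<integral>\<^sup>+t. G t * indicator {2*pi..<2*pi+a} t \<partial>lborel)"
    by (rule nn_integral_add) auto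
  also have "(\<integral>\<^sup>+t. G t * indicator {2*pi..<2*pi+a} t \<partial>lborel) = (\<integral>\<^sup>+t. G t * indicator {0..<a} t \<partial>lborel)"
    by (subst nn_integral_real_affine[of _ 1 "2*pi"])
       (auto intro!: nn_integral_cong simp: indicator_def per)
  also have "(\<integral>\<^sup>+t. G t * indicator {a..<2*pi} t \<partial>lborel) + (\<integral>\<^sup>+t. G t * indicator {0..<a} t \<partial>lborel)
     = (\<integral>\<^sup>+t. G t * indicator {a..<2*pi} t + G t * indicator {0..<a} t \<partial>lborel)"
    by (rule nn_integral_add[symmetric]) auto
  also have "\<dots> = (\<integral>\<^sup>+t. G t * indicator {0..<2*pi} t \<partial>lborel)"
    using a by (intro nn_integral_cong) (auto simp: indicator_def)
  finally show ?thesis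
    by (simp add: nn_integral_circle_measure a G_def cis_mult)
qed

lemma measurable_circle_rotate:
  assumes "cmod w = 1"
  shows "(\<lambda>z. w * z) \<in> circle_measure \<rightarrow>\<^sub>M circle_measure"
proof (rule measurable_into_circle)
  show "(\<lambda>z. w * z) \<in> borel_measurable circle_measure"
    by (rule borel_measurable_times[OF borel_measurable_const measurable_circle_id])
  show "cmod (w * z) = 1" if "z \<in> space circle_measure" for z
    using that assms by (simp add: space_circle_measure norm_mult)
qed

lemma distr_circle_rotate:
  assumes w: "cmod w = 1"
  shows "distr circle_measure circle_measure (\<lambda>z. w * z) = circle_measure"
proof (rule measure_eqI)
  fix A assume "A \<in> sets (distr circle_measure circle_measure (\<lambda>z. w * z))"
  then have A: "A \<in> sets circle_measure" by simp
  then have "A \<in> sets borel"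
    unfolding sets_circle_measure by (auto simp: sets_restrict_space)
  then have [measurable]: "(indicator A :: complex \<Rightarrow> ennreal) \<in> borel_measurable borel" by simp
  note m = measurable_circle_rotate[OF w]
  have "(indicator A :: complex \<Rightarrow> ennreal) \<in> borel_measurable circle_measure"
    using A by (rule borel_measurable_indicator)
  then have 1: "(\<integral>\<^sup>+z. indicator A z \<partial>distr circle_measure circle_measure (\<lambda>z. w * z))
      = (\<integral>\<^sup>+z. indicator A (w * z) \<partial>circle_measure)"
    by (intro nn_integral_distr[OF m]) (simp only: measurable_distr_eq1)
  have 2: "(\<integral>\<^sup>+z. indicator A (w * z) \<partial>circle_measure) = (\<integral>\<^sup>+z. indicator A z \<partial>circle_measure)"
    by (rule nn_integral_circle_rotate[of "indicator A", OF _ w]) fact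
  have "A \<in> sets (distr circle_measure circle_measure (\<lambda>z. w * z))" using A by (simp only: sets_distr)
  from nn_integral_indicator[OF this] nn_integral_indicator[OF A] 1 2
  show "emeasure (distr circle_measure circle_measure (\<lambda>z. w * z)) A = emeasure circle_measure A"
    by (simp only:)
qed (simp only: sets_distr)

lemma measurable_torus_rotate:
  assumes "\<And>k. cmod (w k) = 1"
  shows "(\<lambda>z k. w k * z k) \<in> torus_measure \<rightarrow>\<^sub>M torus_measure"
proof (rule measurable_into_torus)
  show "(\<lambda>z. w k * z k) \<in> borel_measurable torus_measure" for k by measurable
  show "cmod (w k * z k) = 1" if "z \<in> space torus_measure" for z k
    using that by (simp add: space_torus_measure norm_mult assms)
qed

lemma distr_torus_rotate:
  assumes w: "\<And>k. cmod (w k) = 1"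
  shows "distr torus_measure torus_measure (\<lambda>z k. w k * z k) = torus_measure"
proof -
  note m = measurable_circle_rotate[OF w]
  have ind: "torus.indep_vars (\<lambda>_. circle_measure) (\<lambda>k z. w k * z k) UNIV"
    by (rule torus.indep_vars_compose2[OF indep_vars_torus_coords, of "\<lambda>k z. w k * z" "\<lambda>_. circle_measure", OF m])
  have "distr torus_measure circle_measure (\<lambda>z. w k * z k) = circle_measure" for k
    using distr_distr[OF m[of k] measurable_torus_coord_circle[of k]]
    by (simp add: o_def distr_torus_coord distr_circle_rotate[OF w])
  moreover have "distr torus_measure (PiM UNIV (\<lambda>_. circle_measure)) (\<lambda>z. \<lambda>k\<in>UNIV. w k * z k)
      = (\<Pi>\<^sub>M k\<in>UNIV. distr torus_measure circle_measure (\<lambda>z. w k * z k))"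
    by (rule torus.indep_vars_iff_distr_eq_PiM[THEN iffD1, OF _ _ ind])
       (auto intro: measurable_compose[OF measurable_torus_coord_circle m])
  ultimately show ?thesis by (simp add: torus_measure_def restrict_def)
qed

lemma integral_torus_blocks:
  fixes F :: "nat \<Rightarrow> (nat \<Rightarrow> complex) \<Rightarrow> 'b :: {real_normed_field, banach, second_countable_topology}"
  assumes F: "\<And>j. integrable torus_measure (F j)"
  shows "(LINT z|torus_measure. (\<Prod>j<N. F j (\<lambda>k. z (prod_encode (j, k))))) = (\<Prod>j<N. LINT z|torus_measure. F j z)"
proof -
  define K where "K j = range (\<lambda>k. prod_encode (j, k))" for j
  have [measurable]: "F j \<in> borel_measurable torus_measure" for j
    using F by (rule borel_measurable_integrable)
  have r: "torus.indep_vars (\<lambda>j. PiM (K j) (\<lambda>_. circle_measure)) (\<lambda>j z. restrict (\<lambda>i. z i) (K j)) {..<N}"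
    by (rule torus.indep_vars_restrict[OF indep_vars_torus_coords])
       (auto simp: disjoint_family_on_def K_def)
  have "(\<lambda>\<omega>. \<lambda>k. \<omega> (prod_encode (j, k))) \<in> PiM (K j) (\<lambda>_. circle_measure) \<rightarrow>\<^sub>M torus_measure" for j
    unfolding torus_measure_def
    by (rule measurable_PiM_single') (auto simp: K_def space_PiM PiE_def Pi_def)
  then have "(\<lambda>\<omega>. F j (\<lambda>k. \<omega> (prod_encode (j, k)))) \<in> borel_measurable (PiM (K j) (\<lambda>_. circle_measure))" for j
    by measurable
  from torus.indep_vars_compose2[OF r this]
  have ind: "torus.indep_vars (\<lambda>_. borel) (\<lambda>j z. F j (\<lambda>k. z (prod_encode (j, k)))) {..<N}"
    by (simp add: K_def)
  have d: "distr torus_measure torus_measure (\<lambda>z k. z (prod_encode (j, k))) = torus_measure" for j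
    by (rule distr_torus_reindex) (auto simp: inj_def)
  have int: "integrable torus_measure (\<lambda>z. F j (\<lambda>k. z (prod_encode (j, k))))" for j
    using F[of j] by (subst (asm) d[of j, symmetric]) (simp add: integrable_distr_eq measurable_torus_reindex)
  have eq: "(LINT z|torus_measure. F j (\<lambda>k. z (prod_encode (j, k)))) = (LINT z|torus_measure. F j z)" for j
    by (subst (2) d[of j, symmetric]) (simp add: integral_distr measurable_torus_reindex)
  show "(LINT z|torus_measure. (\<Prod>j<N. F j (\<lambda>k. z (prod_encode (j, k))))) = (\<Prod>j<N. LINT z|torus_measure. F j z)"
    using torus.indep_vars_lebesgue_integral[OF _ ind] int eq by simp
qed

section \<open>Moments of sums of coordinates\<close>

definition coord_sum :: "nat \<Rightarrow> (nat \<Rightarrow> complex) \<Rightarrow> complex" where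
  "coord_sum n z = (\<Sum>k<n. z k)"

lemma measurable_coord_sum [measurable]: "coord_sum n \<in> borel_measurable torus_measure"
  unfolding coord_sum_def[abs_def] by measurable

lemma norm_coord_sum_le: "z \<in> space torus_measure \<Longrightarrow> cmod (coord_sum n z) \<le> real n"
  unfolding coord_sum_def by (rule order_trans[OF norm_sum]) (simp add: space_torus_measure)

lemma coord_sum_mult: "coord_sum n (\<lambda>k. w * z k) = w * coord_sum n z"
  by (simp add: coord_sum_def sum_distrib_left)

lemma integral_torus_rotate:
  fixes f :: "(nat \<Rightarrow> complex) \<Rightarrow> 'b :: {banach, second_countable_topology}"
  assumes "\<And>k. cmod (w k) = 1" "f \<in> borel_measurable torus_measure"
  shows "(LINT z|torus_measure. f (\<lambda>k. w k * z k)) = (LINT z|torus_measure. f z)"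
  using integral_distr[OF measurable_torus_rotate[OF assms(1)] assms(2)]
  by (simp only: distr_torus_rotate[OF assms(1)])

lemma nn_integral_torus_rotate:
  assumes "\<And>k. cmod (w k) = 1" "f \<in> borel_measurable torus_measure"
  shows "(\<integral>\<^sup>+z. f (\<lambda>k. w k * z k) \<partial>torus_measure) = (\<integral>\<^sup>+z. f z \<partial>torus_measure)"
proof -
  have "(\<integral>\<^sup>+z. f z \<partial>distr torus_measure torus_measure (\<lambda>z k. w k * z k))
      = (\<integral>\<^sup>+z. f (\<lambda>k. w k * z k) \<partial>torus_measure)"
    by (rule nn_integral_distr[OF measurable_torus_rotate[OF assms(1)]])
       (simp only: measurable_distr_eq1 assms(2))
  then show ?thesis by (simp only: distr_torus_rotate[OF assms(1)])
qed

lemma integrable_torus_bounded: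
  fixes f :: "(nat \<Rightarrow> complex) \<Rightarrow> 'b :: {banach, second_countable_topology}"
  assumes "f \<in> borel_measurable torus_measure" "\<And>z. z \<in> space torus_measure \<Longrightarrow> norm (f z) \<le> B"
  shows "integrable torus_measure f"
  by (rule torus.integrable_const_bound[of _ B]) (use assms in auto)

lemma circle_abs_Re_moment_mult:
  fixes r :: real
  assumes r: "0 < r"
  shows "(\<integral>\<^sup>+w. ennreal (\<bar>Re (w * c)\<bar> powr r) \<partial>circle_measure)
         = ennreal (Gamma ((r + 1) / 2) / (sqrt pi * Gamma (1 + r / 2))) * ennreal (cmod c powr r)"
proof (cases "c = 0")
  case False
  define f where "f = (\<lambda>w. ennreal (\<bar>Re w\<bar> powr r))"
  have f: "f \<in> borel_measurable borel" unfolding f_def by measurable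
  have m: "(\<lambda>w. f w) \<in> borel_measurable circle_measure"
    by (rule measurable_compose[OF measurable_circle_id f])
  have s: "cmod (sgn c) = 1" using False by (simp add: norm_sgn)
  have m': "(\<lambda>w. f (sgn c * w)) \<in> borel_measurable circle_measure"
    by (rule measurable_compose[OF measurable_circle_rotate[OF s] m])
  have eq: "ennreal (\<bar>Re (w * c)\<bar> powr r) = ennreal (cmod c powr r) * f (sgn c * w)" for w
  proof -
    have "w * c = of_real (cmod c) * (sgn c * w)" using False by (simp add: sgn_eq)
    then have "\<bar>Re (w * c)\<bar> = cmod c * \<bar>Re (sgn c * w)\<bar>"
      by (metis Re_complex_of_real abs_mult abs_norm_cancel Im_complex_of_real mult_zero_left times_complex.sel(1) diff_zero)
    then show ?thesis by (simp add: f_def powr_mult ennreal_mult)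
  qed
  show ?thesis
    unfolding eq nn_integral_cmult[OF m'] nn_integral_circle_rotate[OF f s]
    by (simp add: f_def circle_abs_Re_moment[OF r] mult.commute)
qed (use r in simp)

text \<open>
  Rotating all coordinates by a common \<open>w\<close> preserves the measure; averaging over \<open>w\<close> trades the real part
  for the modulus, so the one-dimensional central limit theorem suffices.
\<close>

lemma nn_integral_coord_sum_Re:
  fixes r :: real
  assumes r: "0 < r"
  shows "(\<integral>\<^sup>+z. ennreal (\<bar>Re (coord_sum n z)\<bar> powr r) \<partial>torus_measure)
     = ennreal (Gamma ((r + 1) / 2) / (sqrt pi * Gamma (1 + r / 2))) *
       (\<integral>\<^sup>+z. ennreal (cmod (coord_sum n z) powr r) \<partial>torus_measure)"
proof -
  interpret P: pair_sigma_finite circle_measure torus_measure ..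
  let ?I = "\<integral>\<^sup>+z. ennreal (\<bar>Re (coord_sum n z)\<bar> powr r) \<partial>torus_measure"
  have 1: "(\<integral>\<^sup>+z. ennreal (\<bar>Re (w * coord_sum n z)\<bar> powr r) \<partial>torus_measure) = ?I" if "w \<in> space circle_measure" for w
  proof -
    have m: "(\<lambda>z. ennreal (\<bar>Re (coord_sum n z)\<bar> powr r)) \<in> borel_measurable torus_measure" by measurable
    have "cmod w = 1" using that by (simp add: space_circle_measure)
    from nn_integral_torus_rotate[of "\<lambda>_. w", OF this m] show ?thesis by (simp only: coord_sum_mult)
  qed
  have [measurable]: "(\<lambda>x. fst x) \<in> borel_measurable (circle_measure \<Otimes>\<^sub>M torus_measure)"
    by (rule measurable_compose[OF measurable_fst measurable_circle_id])
  have "?I = (\<integral>\<^sup>+w. ?I \<partial>circle_measure)"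
    by (simp add: circle.emeasure_space_1)
  also have "\<dots> = (\<integral>\<^sup>+w. \<integral>\<^sup>+z. ennreal (\<bar>Re (w * coord_sum n z)\<bar> powr r) \<partial>torus_measure \<partial>circle_measure)"
    by (rule nn_integral_cong) (simp only: 1)
  also have "\<dots> = (\<integral>\<^sup>+z. \<integral>\<^sup>+w. ennreal (\<bar>Re (w * coord_sum n z)\<bar> powr r) \<partial>circle_measure \<partial>torus_measure)"
    by (rule P.Fubini'[symmetric]) (simp add: split_beta')
  also have "\<dots> = (\<integral>\<^sup>+z. ennreal (Gamma ((r + 1) / 2) / (sqrt pi * Gamma (1 + r / 2))) *
       ennreal (cmod (coord_sum n z) powr r) \<partial>torus_measure)"
    by (simp only: circle_abs_Re_moment_mult[OF r])
  also have "\<dots> = ennreal (Gamma ((r + 1) / 2) / (sqrt pi * Gamma (1 + r / 2))) *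
       (\<integral>\<^sup>+z. ennreal (cmod (coord_sum n z) powr r) \<partial>torus_measure)"
    by (rule nn_integral_cmult) measurable
  finally show ?thesis .
qed

lemma integrable_coord_sum_powr:
  assumes "0 < r"
  shows "integrable torus_measure (\<lambda>z. cmod (coord_sum n z) powr r)"
    "integrable torus_measure (\<lambda>z. \<bar>Re (coord_sum n z)\<bar> powr r)"
proof -
  have le: "x powr r \<le> real n powr r" if "z \<in> space torus_measure" "0 \<le> x" "x \<le> cmod (coord_sum n z)" for x z
    using that norm_coord_sum_le[of z n] assms by (intro powr_mono2) auto
  show "integrable torus_measure (\<lambda>z. cmod (coord_sum n z) powr r)"
    by (rule integrable_torus_bounded[of _ "real n powr r"]) (use le in auto)
  show "integrable torus_measure (\<lambda>z. \<bar>Re (coord_sum n z)\<bar> powr r)"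
    by (rule integrable_torus_bounded[of _ "real n powr r"]) (use le abs_Re_le_cmod in auto)
qed

lemma integral_coord_sum_Re:
  fixes r :: real
  assumes r: "0 < r"
  shows "(LINT z|torus_measure. \<bar>Re (coord_sum n z)\<bar> powr r)
     = Gamma ((r + 1) / 2) / (sqrt pi * Gamma (1 + r / 2)) * (LINT z|torus_measure. cmod (coord_sum n z) powr r)"
proof -
  have G: "0 < Gamma ((r + 1) / 2)" "0 < Gamma (1 + r / 2)" using r by (auto intro!: Gamma_real_pos add_pos_pos)
  have 0: "0 \<le> (LINT z|torus_measure. cmod (coord_sum n z) powr r)" "0 \<le> (LINT z|torus_measure. \<bar>Re (coord_sum n z)\<bar> powr r)"
    by (rule Bochner_Integration.integral_nonneg; simp)+
  have "ennreal (LINT z|torus_measure. \<bar>Re (coord_sum n z)\<bar> powr r)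
     = ennreal (Gamma ((r + 1) / 2) / (sqrt pi * Gamma (1 + r / 2))) * ennreal (LINT z|torus_measure. cmod (coord_sum n z) powr r)"
    using nn_integral_coord_sum_Re[OF r, of n]
    by (simp add: nn_integral_eq_integral integrable_coord_sum_powr[OF r])
  also have "\<dots> = ennreal (Gamma ((r + 1) / 2) / (sqrt pi * Gamma (1 + r / 2)) * (LINT z|torus_measure. cmod (coord_sum n z) powr r))"
    using G 0 by (intro ennreal_mult[symmetric]) auto
  finally show ?thesis
    using G 0 by (subst (asm) ennreal_inj) auto
qed

lemma clt_coord_sum:
  "weak_conv_m (\<lambda>n. distr torus_measure borel (\<lambda>z. sqrt 2 * Re (coord_sum n z) / sqrt n)) std_normal_distribution"
proof -
  define X where "X k z = sqrt 2 * Re (z k)" for k :: nat and z :: "nat \<Rightarrow> complex"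
  have mX[measurable]: "X k \<in> borel_measurable torus_measure" for k
    unfolding X_def[abs_def] by measurable
  have ind: "torus.indep_vars (\<lambda>_. borel) X UNIV"
    unfolding X_def[abs_def]
  proof (rule torus.indep_vars_compose2[OF indep_vars_torus_coords])
    have "(\<lambda>w. sqrt 2 * Re w) \<in> borel_measurable borel" by measurable
    from measurable_compose[OF measurable_circle_id this]
    show "(\<lambda>w. sqrt 2 * Re w) \<in> borel_measurable circle_measure" .
  qed
  have bound: "norm (Re (z k)) \<le> 1" "norm (Im (z k)) \<le> 1" if "z \<in> space torus_measure" for z k
    using that abs_Re_le_cmod[of "z k"] abs_Im_le_cmod[of "z k"] by (auto simp: space_torus_measure)
  have intRe: "integrable torus_measure (\<lambda>z. Re (z k))" for k
    by (rule integrable_torus_bounded[of _ 1]) (use bound in auto)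
  have int2: "integrable torus_measure (\<lambda>z. (Re (z k))\<^sup>2)" "integrable torus_measure (\<lambda>z. (Im (z k))\<^sup>2)" for k
    by (rule integrable_torus_bounded[of _ 1]; use bound in \<open>auto simp: abs_square_le_1\<close>)+
  have "(LINT z|torus_measure. Re (-1 * z k)) = (LINT z|torus_measure. Re (z k))" for k
    by (rule integral_torus_rotate[where w = "\<lambda>_. -1"]) auto
  then have mean: "(LINT z|torus_measure. Re (z k)) = 0" for k by simp
  have "(LINT z|torus_measure. (Re (\<i> * z k))\<^sup>2) = (LINT z|torus_measure. (Re (z k))\<^sup>2)" for k
    by (rule integral_torus_rotate[where w = "\<lambda>_. \<i>" and f = "\<lambda>z. (Re (z k))\<^sup>2"]) auto
  then have ReIm: "(LINT z|torus_measure. (Im (z k))\<^sup>2) = (LINT z|torus_measure. (Re (z k))\<^sup>2)" for k by simp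
  have "(LINT z|torus_measure. (Re (z k))\<^sup>2 + (Im (z k))\<^sup>2) = (LINT z|torus_measure. 1)" for k
    by (rule Bochner_Integration.integral_cong[OF refl])
       (simp add: space_torus_measure cmod_power2[symmetric])
  then have sq: "(LINT z|torus_measure. (Re (z k))\<^sup>2) = 1/2" for k
    using ReIm[of k] Bochner_Integration.integral_add[OF int2(1)[of k] int2(2)[of k]] by (simp add: torus.prob_space)
  have EX: "torus.expectation (X k) = 0" for k using mean[of k] by (simp add: X_def[abs_def])
  have "weak_conv_m (\<lambda>n. distr torus_measure borel (\<lambda>z. (\<Sum>i<n. X i z) / sqrt (real n * 1\<^sup>2))) std_normal_distribution"
  proof (rule torus.central_limit_theorem_zero_mean[OF ind EX])
    show "integrable torus_measure (\<lambda>z. (X k z)\<^sup>2)" for k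
      using int2(1)[of k] by (simp add: X_def power_mult_distrib)
    show "torus.variance (X k) = 1\<^sup>2" for k
      unfolding EX using sq[of k] by (simp add: X_def[abs_def] power_mult_distrib)
    show "distr torus_measure borel (X k) = distr circle_measure borel (\<lambda>w. sqrt 2 * Re w)" for k
    proof -
      have "(\<lambda>w. sqrt 2 * Re w) \<in> borel_measurable borel" by measurable
      from measurable_compose[OF measurable_circle_id this]
      have "(\<lambda>w. sqrt 2 * Re w) \<in> borel_measurable circle_measure" .
      from distr_distr[OF this measurable_torus_coord_circle[of k]]
      show ?thesis unfolding distr_torus_coord X_def[abs_def] o_def ..
    qed
  qed simp
  moreover have "(\<Sum>i<n. X i z) = sqrt 2 * Re (coord_sum n z)" for n z
    by (simp add: X_def coord_sum_def sum_distrib_left)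
  ultimately show ?thesis by simp
qed

lemma eventually_moment_gt:
  fixes r L :: real
  assumes r: "0 < r" and L: "0 < L" "L < Gamma (1 + r / 2)"
  shows "eventually (\<lambda>n. L < (LINT z|torus_measure. (cmod (coord_sum n z) / sqrt n) powr r)) sequentially"
proof -
  define D where "D = 2 powr (r / 2) * (Gamma ((r + 1) / 2) / (sqrt pi * Gamma (1 + r / 2)))"
  have G: "0 < Gamma ((r + 1) / 2)" "0 < Gamma (1 + r / 2)" using r by (auto intro!: Gamma_real_pos add_pos_pos)
  then have D: "D > 0" by (simp add: D_def)
  define f where "f m x = min (\<bar>x\<bar> powr r) (real m)" for m :: nat and x :: real
  have mono: "incseq (\<lambda>m x. ennreal (f m x))"
    by (auto simp: incseq_def le_fun_def f_def intro!: ennreal_leI)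
  have SUP: "(SUP m. ennreal (f m x)) = ennreal (\<bar>x\<bar> powr r)" for x
  proof (rule antisym)
    obtain m where "\<bar>x\<bar> powr r \<le> real m" using real_arch_simple by blast
    then have "ennreal (\<bar>x\<bar> powr r) = ennreal (f m x)" by (simp add: f_def min_absorb1)
    then show "ennreal (\<bar>x\<bar> powr r) \<le> (SUP m. ennreal (f m x))" by (auto intro: SUP_upper)
  qed (auto intro!: SUP_least ennreal_leI simp: f_def)
  have fm[measurable]: "f m \<in> borel_measurable borel" for m unfolding f_def[abs_def] by measurable
  interpret N: real_distribution std_normal_distribution by (rule real_dist_normal_dist)
  have fint: "integrable std_normal_distribution (f m)" for m
    by (rule N.integrable_const_bound[of _ m]) (auto simp: f_def)
  have "ennreal (L * D) < ennreal (2 powr (r / 2) * Gamma ((r + 1) / 2) / sqrt pi)"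
  proof (rule ennreal_lessI)
    have "L * D < Gamma (1 + r / 2) * D" using L D by simp
    also have "\<dots> = 2 powr (r / 2) * Gamma ((r + 1) / 2) / sqrt pi" using G by (simp add: D_def)
    finally show "L * D < 2 powr (r / 2) * Gamma ((r + 1) / 2) / sqrt pi" .
  qed (use G in simp)
  also have "\<dots> = (\<integral>\<^sup>+x. (SUP m. ennreal (f m x)) \<partial>std_normal_distribution)"
    by (simp only: SUP std_normal_abs_moment[OF r])
  also have "\<dots> = (SUP m. \<integral>\<^sup>+x. ennreal (f m x) \<partial>std_normal_distribution)"
    by (rule nn_integral_monotone_convergence_SUP[OF mono]) (rule measurable_compose[OF _ measurable_ennreal], simp)
  finally obtain m where "ennreal (L * D) < (\<integral>\<^sup>+x. ennreal (f m x) \<partial>std_normal_distribution)"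
    unfolding less_SUP_iff by blast
  then have m: "L * D < integral\<^sup>L std_normal_distribution (f m)"
    using fint[of m] L D by (subst (asm) nn_integral_eq_integral) (auto simp: f_def ennreal_less_iff)
  have mS[measurable]: "(\<lambda>z. sqrt 2 * Re (coord_sum n z) / sqrt n) \<in> borel_measurable torus_measure" for n by measurable
  have "(\<lambda>n. integral\<^sup>L (distr torus_measure borel (\<lambda>z. sqrt 2 * Re (coord_sum n z) / sqrt n)) (f m))
      \<longlonglongrightarrow> integral\<^sup>L std_normal_distribution (f m)"
  proof (rule weak_conv_imp_integral_bdd_continuous_conv)
    show "real_distribution (distr torus_measure borel (\<lambda>z. sqrt 2 * Re (coord_sum n z) / sqrt n))" for n
      by (rule torus.real_distribution_distr) measurable
    show "isCont (f m) x" for x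
    proof -
      have "continuous_on UNIV (f m)"
        unfolding f_def[abs_def] using r by (intro continuous_on_min continuous_on_powr' continuous_intros) auto
      then show ?thesis by (simp add: continuous_on_eq_continuous_at)
    qed
    show "norm (f m x) \<le> real m" for x by (auto simp: f_def)
  qed (rule real_dist_normal_dist clt_coord_sum)+
  from order_tendstoD(1)[OF this m] eventually_gt_at_top[of 0]
  show ?thesis
  proof eventually_elim
    case (elim n)
    have "L * D < (LINT z|torus_measure. f m (sqrt 2 * Re (coord_sum n z) / sqrt n))"
      using elim(1) by (subst (asm) integral_distr) auto
    also have "\<dots> \<le> (LINT z|torus_measure. 2 powr (r / 2) / sqrt n powr r * \<bar>Re (coord_sum n z)\<bar> powr r)"
    proof (rule Bochner_Integration.integral_mono)
      show "integrable torus_measure (\<lambda>z. f m (sqrt 2 * Re (coord_sum n z) / sqrt n))"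
        by (rule integrable_torus_bounded[of _ "real m"]) (auto simp: f_def)
      show "integrable torus_measure (\<lambda>z. 2 powr (r / 2) / sqrt n powr r * \<bar>Re (coord_sum n z)\<bar> powr r)"
        using integrable_coord_sum_powr(2)[OF r] by (rule integrable_mult_right)
      fix z
      have "sqrt 2 powr r = 2 powr (r / 2)" by (simp add: powr_half_sqrt[symmetric] powr_powr)
      then have "\<bar>sqrt 2 * Re (coord_sum n z) / sqrt n\<bar> powr r = 2 powr (r / 2) / sqrt n powr r * \<bar>Re (coord_sum n z)\<bar> powr r"
        by (simp add: abs_mult powr_mult powr_divide)
      then show "f m (sqrt 2 * Re (coord_sum n z) / sqrt n) \<le> 2 powr (r / 2) / sqrt n powr r * \<bar>Re (coord_sum n z)\<bar> powr r"
        by (simp add: f_def)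
    qed
    also have "\<dots> = D * (LINT z|torus_measure. 1 / sqrt n powr r * cmod (coord_sum n z) powr r)"
      by (simp add: integral_coord_sum_Re[OF r] D_def)
    also have "(\<lambda>z. 1 / sqrt n powr r * cmod (coord_sum n z) powr r) = (\<lambda>z. (cmod (coord_sum n z) / sqrt n) powr r)"
      by (simp add: powr_divide)
    finally show ?case using D by (simp add: mult.commute)
  qed
qed

section \<open>The Riesz projection of products of signs\<close>

lemma measurable_cnj [measurable]: "cnj \<in> borel_measurable borel"
  by (intro borel_measurable_continuous_onI continuous_intros)

lemma measurable_monomial [measurable]: "monomial \<alpha> \<in> borel_measurable torus_measure"
proof -
  have "(\<lambda>x::complex. x powi k) \<in> borel_measurable borel" for k
    by (cases k) (simp_all add: power_int_def)
  then have "(\<lambda>z. z j powi \<alpha> j) \<in> borel_measurable torus_measure" for j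
    by (rule measurable_compose[OF measurable_torus_coord])
  then show ?thesis unfolding monomial_def[abs_def] by (intro borel_measurable_prod)
qed

lemma norm_monomial: "z \<in> space torus_measure \<Longrightarrow> cmod (monomial \<alpha> z) = 1"
  by (simp add: monomial_def space_torus_measure prod_norm[symmetric] norm_power_int)

lemma prod_powi_sum:
  fixes w :: "'a :: field"
  assumes "finite A" "w \<noteq> 0"
  shows "(\<Prod>m\<in>A. w powi f m) = w powi (\<Sum>m\<in>A. f m)"
  using assms by (induction A rule: finite_induct) (simp_all add: power_int_add)

lemma monomial_rotate:
  assumes "\<alpha> \<in> int_multiindices" "w \<noteq> 0"
  shows "monomial \<alpha> (\<lambda>m. (if m \<in> J then w else 1) * z m)
       = w powi (\<Sum>m | \<alpha> m \<noteq> 0 \<and> m \<in> J. \<alpha> m) * monomial \<alpha> z"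
proof -
  have fin: "finite {m. \<alpha> m \<noteq> 0}" using assms by (simp add: int_multiindices_def)
  have "(\<Prod>m | \<alpha> m \<noteq> 0. (if m \<in> J then w else 1) powi \<alpha> m)
      = (\<Prod>m | \<alpha> m \<noteq> 0. if m \<in> J then w powi \<alpha> m else 1)"
    by (intro prod.cong) auto
  also have "\<dots> = (\<Prod>m | \<alpha> m \<noteq> 0 \<and> m \<in> J. w powi \<alpha> m)"
    by (subst prod.inter_filter[OF fin, symmetric]) (intro prod.cong; auto)
  also have "\<dots> = w powi (\<Sum>m | \<alpha> m \<noteq> 0 \<and> m \<in> J. \<alpha> m)"
    by (rule prod_powi_sum) (use fin assms in \<open>auto intro: finite_subset\<close>)
  finally show ?thesis
    by (simp add: monomial_def power_int_mult_distrib prod.distrib)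
qed

lemma fourier_coeff_rotate:
  assumes f: "f \<in> borel_measurable torus_measure" and \<alpha>: "\<alpha> \<in> int_multiindices"
    and rot: "\<And>w z. cmod w = 1 \<Longrightarrow> f (\<lambda>m. (if m \<in> J then w else 1) * z m) = w powi e * f z"
    and nz: "fourier_coeff f \<alpha> \<noteq> 0"
  shows "(\<Sum>m | \<alpha> m \<noteq> 0 \<and> m \<in> J. \<alpha> m) = e"
proof (rule ccontr)
  define s where "s = (\<Sum>m | \<alpha> m \<noteq> 0 \<and> m \<in> J. \<alpha> m)"
  assume "(\<Sum>m | \<alpha> m \<noteq> 0 \<and> m \<in> J. \<alpha> m) \<noteq> e"
  then have d: "s - e \<noteq> 0" by (simp add: s_def)
  define w where "w = cis (pi / of_int (s - e))"
  have w: "cmod w = 1" "w \<noteq> 0" "w powi (s - e) = -1"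
    using d by (auto simp: w_def cis_power_int simp del: of_int_diff)
  have [measurable]: "f \<in> borel_measurable torus_measure" by (rule f)
  have m: "(\<lambda>z. f z * cnj (monomial \<alpha> z)) \<in> borel_measurable torus_measure"
    by measurable
  have eq: "w powi e * f z * cnj (w powi s * monomial \<alpha> z) = - (f z * cnj (monomial \<alpha> z))" for z
  proof -
    have "cmod (w powi s) = 1" using w by (simp add: norm_power_int)
    then have "w powi s * cnj (w powi s) = 1"
      using complex_norm_square[of "w powi s"] by (simp only: power_one of_real_1)
    then have "cnj (w powi s) = inverse (w powi s)" by (metis inverse_unique)
    then have "w powi e * cnj (w powi s) = inverse (w powi s / w powi e)" by (simp add: divide_inverse)
    also have "\<dots> = inverse (w powi (s - e))" using w(2) by (simp add: power_int_diff)
    also have "\<dots> = -1" by (simp add: w)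
    finally show ?thesis by (simp add: algebra_simps)
  qed
  have "fourier_coeff f \<alpha> = (LINT z|torus_measure. f (\<lambda>m. (if m \<in> J then w else 1) * z m) * cnj (monomial \<alpha> (\<lambda>m. (if m \<in> J then w else 1) * z m)))"
    unfolding fourier_coeff_def
    by (rule integral_torus_rotate[OF _ m, symmetric]) (use w in auto)
  also have "\<dots> = (LINT z|torus_measure. w powi e * f z * cnj (w powi s * monomial \<alpha> z))"
    by (simp only: rot[OF w(1)] monomial_rotate[OF \<alpha> w(2)] s_def)
  also have "\<dots> = - fourier_coeff f \<alpha>"
    unfolding eq fourier_coeff_def by simp
  finally show False using nz by simp
qed


lemma riesz_projection_polynomial:
  assumes B: "finite B" "B \<subseteq> nonneg_multiindices"
    and zero: "\<And>\<alpha>. \<alpha> \<in> nonneg_multiindices - B \<Longrightarrow> fourier_coeff f \<alpha> = 0"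
  shows "riesz_projection f \<in> borel_measurable torus_measure"
    and "AE z in torus_measure. riesz_projection f z = (\<Sum>\<alpha>\<in>B. fourier_coeff f \<alpha> * monomial \<alpha> z)"
proof -
  define g where "g = (\<lambda>z. \<Sum>\<alpha>\<in>B. fourier_coeff f \<alpha> * monomial \<alpha> z)"
  define h where "h = riesz_projection f"
  define K where "K = (\<Sum>\<alpha>\<in>B. cmod (fourier_coeff f \<alpha>))"
  have g[measurable]: "g \<in> borel_measurable torus_measure" unfolding g_def by measurable
  have gK: "cmod (g z) \<le> K" if "z \<in> space torus_measure" for z
    unfolding g_def K_def
    by (rule order_trans[OF norm_sum]) (use that in \<open>simp add: norm_mult norm_monomial\<close>)
  have g2: "integrable torus_measure (\<lambda>z. (cmod (g z))\<^sup>2)"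
    by (rule integrable_torus_bounded[of _ "K\<^sup>2"]) (use gK in \<open>auto intro!: power_mono\<close>)
  have gL: "g \<in> Lp 2"
    using g g2 by (simp add: Lp_def)
  define P where "P h \<longleftrightarrow> h \<in> Lp 2 \<and>
        ((\<lambda>A. Lp_norm 2 (\<lambda>z. h z - (\<Sum>\<alpha>\<in>A. fourier_coeff f \<alpha> * monomial \<alpha> z))) \<longlongrightarrow> 0)
          (finite_subsets_at_top nonneg_multiindices)" for h
  have ev: "eventually (\<lambda>A. (\<lambda>z. \<Sum>\<alpha>\<in>A. fourier_coeff f \<alpha> * monomial \<alpha> z) = g) (finite_subsets_at_top nonneg_multiindices)"
    unfolding eventually_finite_subsets_at_top
  proof (intro exI[of _ B] conjI allI impI ext)
    fix A z assume "finite A \<and> B \<subseteq> A \<and> A \<subseteq> nonneg_multiindices"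
    then show "(\<Sum>\<alpha>\<in>A. fourier_coeff f \<alpha> * monomial \<alpha> z) = g z"
      unfolding g_def using zero by (intro sum.mono_neutral_right) auto
  qed (use B in auto)
  have "P g" unfolding P_def
  proof (intro conjI gL tendsto_eventually)
    show "\<forall>\<^sub>F A in finite_subsets_at_top nonneg_multiindices. Lp_norm 2 (\<lambda>z. g z - (\<Sum>\<alpha>\<in>A. fourier_coeff f \<alpha> * monomial \<alpha> z)) = 0"
      using ev
    proof eventually_elim
      case (elim A)
      have "(\<Sum>\<alpha>\<in>A. fourier_coeff f \<alpha> * monomial \<alpha> z) = g z" for z using fun_cong[OF elim] .
      then show ?case by (simp add: Lp_norm_def)
    qed
  qed
  then have "P (SOME g. P g)" by (rule someI[of P])
  moreover have "h = (SOME g. P g)" by (simp add: h_def riesz_projection_def P_def)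
  ultimately have "P h" by simp
  then have hL: "h \<in> Lp 2" and lim: "((\<lambda>A. Lp_norm 2 (\<lambda>z. h z - (\<Sum>\<alpha>\<in>A. fourier_coeff f \<alpha> * monomial \<alpha> z))) \<longlongrightarrow> 0)
          (finite_subsets_at_top nonneg_multiindices)"
    by (simp_all add: P_def)
  show h: "riesz_projection f \<in> borel_measurable torus_measure"
    using hL by (simp add: Lp_def h_def)
  then have [measurable]: "h \<in> borel_measurable torus_measure" by (simp add: h_def)
  have h2: "integrable torus_measure (\<lambda>z. (cmod (h z))\<^sup>2)"
    using hL by (simp add: Lp_def)
  have "((\<lambda>A. Lp_norm 2 (\<lambda>z. h z - (\<Sum>\<alpha>\<in>A. fourier_coeff f \<alpha> * monomial \<alpha> z))) \<longlongrightarrow> Lp_norm 2 (\<lambda>z. h z - g z))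
          (finite_subsets_at_top nonneg_multiindices)"
    by (rule tendsto_eventually, use ev in eventually_elim) (metis (no_types, lifting))
  then have "Lp_norm 2 (\<lambda>z. h z - g z) = 0"
    by (rule tendsto_unique[OF _ _ lim, rotated]) simp
  then have 0: "(LINT z|torus_measure. (cmod (h z - g z))\<^sup>2) = 0"
    by (simp add: Lp_norm_def)
  have "integrable torus_measure (\<lambda>z. (cmod (h z - g z))\<^sup>2)"
  proof (rule Bochner_Integration.integrable_bound)
    show "integrable torus_measure (\<lambda>z. 2 * (cmod (h z))\<^sup>2 + 2 * (cmod (g z))\<^sup>2)"
      using h2 g2 by simp
    show "AE z in torus_measure. norm ((cmod (h z - g z))\<^sup>2) \<le> norm (2 * (cmod (h z))\<^sup>2 + 2 * (cmod (g z))\<^sup>2)"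
    proof (intro AE_I2)
      fix z
      have "(cmod (h z - g z))\<^sup>2 \<le> (cmod (h z) + cmod (g z))\<^sup>2"
        by (intro power_mono norm_triangle_ineq4) auto
      also have "\<dots> \<le> 2 * (cmod (h z))\<^sup>2 + 2 * (cmod (g z))\<^sup>2"
        using sum_squares_bound[of "cmod (h z)" "cmod (g z)"] by (simp add: power2_sum)
      finally show "norm ((cmod (h z - g z))\<^sup>2) \<le> norm (2 * (cmod (h z))\<^sup>2 + 2 * (cmod (g z))\<^sup>2)" by simp
    qed
  qed measurable
  from integral_nonneg_eq_0_iff_AE[OF this] 0
  have "AE z in torus_measure. (cmod (h z - g z))\<^sup>2 = 0" by simp
  then show "AE z in torus_measure. riesz_projection f z = (\<Sum>\<alpha>\<in>B. fourier_coeff f \<alpha> * monomial \<alpha> z)"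
    by (auto simp: h_def g_def elim!: eventually_mono)
qed

abbreviation block :: "nat \<Rightarrow> (nat \<Rightarrow> complex) \<Rightarrow> nat \<Rightarrow> complex" where
  "block j z \<equiv> \<lambda>k. z (prod_encode (j, k))"

definition sgn_prod :: "nat \<Rightarrow> nat \<Rightarrow> (nat \<Rightarrow> complex) \<Rightarrow> complex" where
  "sgn_prod n N z = (\<Prod>j<N. sgn (coord_sum n (block j z)))"

text \<open>
  The exponent of the monomial that picks the coordinate \<open>\<phi> j\<close> from each block \<open>j < N\<close>.
\<close>

definition choice_index :: "nat \<Rightarrow> (nat \<Rightarrow> nat) \<Rightarrow> nat \<Rightarrow> int" where
  "choice_index N \<phi> m = (case prod_decode m of (j, k) \<Rightarrow> if j < N \<and> k = \<phi> j then 1 else 0)"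

definition sgn_coeff :: "nat \<Rightarrow> complex" where
  "sgn_coeff n = of_real ((LINT z|torus_measure. cmod (coord_sum n z)) / real n)"

lemma choice_index_encode: "choice_index N \<phi> (prod_encode (j, k)) = (if j < N \<and> k = \<phi> j then 1 else 0)"
  by (simp add: choice_index_def)

lemma choice_index_support: "{m. choice_index N \<phi> m \<noteq> 0} = (\<lambda>j. prod_encode (j, \<phi> j)) ` {..<N}"
proof (intro set_eqI iffI)
  fix m assume "m \<in> {m. choice_index N \<phi> m \<noteq> 0}"
  then show "m \<in> (\<lambda>j. prod_encode (j, \<phi> j)) ` {..<N}"
    by (cases "prod_decode m") (auto simp: choice_index_def split: if_splits intro!: image_eqI dest: arg_cong[of _ _ prod_encode])
qed (auto simp: choice_index_encode)

lemma monomial_choice_index: "monomial (choice_index N \<phi>) z = (\<Prod>j<N. block j z (\<phi> j))"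
  unfolding monomial_def choice_index_support
  by (subst prod.reindex) (auto simp: inj_on_def choice_index_encode)

lemma choice_index_nonneg: "choice_index N \<phi> \<in> nonneg_multiindices"
  unfolding nonneg_multiindices_def int_multiindices_def mem_Collect_eq choice_index_support
  by (auto simp: choice_index_def split: prod.splits)

lemma inj_choice_index: "inj_on (choice_index N) (PiE {..<N} (\<lambda>_. {..<n}))"
proof (rule inj_onI)
  fix \<phi> \<psi> assume *: "\<phi> \<in> PiE {..<N} (\<lambda>_. {..<n})" "\<psi> \<in> PiE {..<N} (\<lambda>_. {..<n})" "choice_index N \<phi> = choice_index N \<psi>"
  show "\<phi> = \<psi>"
  proof (rule PiE_ext[OF *(1,2)])
    fix j assume "j \<in> {..<N}"
    then show "\<phi> j = \<psi> j"
      using fun_cong[OF *(3), of "prod_encode (j, \<phi> j)"] by (simp add: choice_index_encode split: if_splits)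
  qed
qed

lemma measurable_sgn_complex [measurable]: "(sgn :: complex \<Rightarrow> complex) \<in> borel_measurable borel"
proof -
  have "(\<lambda>z::complex. z /\<^sub>R norm z) \<in> borel_measurable borel" by measurable
  then show ?thesis by (simp add: sgn_div_norm[abs_def])
qed

lemma measurable_block: "block j \<in> torus_measure \<rightarrow>\<^sub>M torus_measure"
  by (rule measurable_torus_reindex)

lemma measurable_sgn_prod [measurable]: "sgn_prod n N \<in> borel_measurable torus_measure"
  unfolding sgn_prod_def[abs_def]
  by (intro borel_measurable_prod measurable_compose[OF _ measurable_sgn_complex]
      measurable_compose[OF measurable_block measurable_coord_sum])

lemma norm_sgn_prod_le: "cmod (sgn_prod n N z) \<le> 1"
  unfolding sgn_prod_def prod_norm[symmetric] by (rule prod_le_1) (auto simp: norm_sgn)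

lemma integral_sgn_coord_sum:
  assumes "i < n"
  shows "(LINT z|torus_measure. sgn (coord_sum n z) * cnj (z i)) = sgn_coeff n"
proof -
  define c where "c i = (LINT z|torus_measure. sgn (coord_sum n z) * cnj (z i))" for i
  have int: "integrable torus_measure (\<lambda>z. sgn (coord_sum n z) * cnj (z i))" for i
    by (rule integrable_torus_bounded[of _ 1])
       (auto simp: norm_mult norm_sgn space_torus_measure)
  have c: "c i = c 0" if "i < n" for i
  proof -
    define \<sigma> where "\<sigma> = Transposition.transpose 0 i"
    have inj: "inj \<sigma>" by (simp add: \<sigma>_def)
    have bij: "bij_betw \<sigma> {..<n} {..<n}"
      using that by (auto simp: \<sigma>_def bij_betw_transpose_iff)
    have S: "coord_sum n (\<lambda>k. z (\<sigma> k)) = coord_sum n z" for z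
      unfolding coord_sum_def by (rule sum.reindex_bij_betw[OF bij])
    have "c 0 = (LINT z|distr torus_measure torus_measure (\<lambda>z k. z (\<sigma> k)). sgn (coord_sum n z) * cnj (z 0))"
      by (simp add: c_def distr_torus_reindex[OF inj])
    also have "\<dots> = (LINT z|torus_measure. sgn (coord_sum n (\<lambda>k. z (\<sigma> k))) * cnj (z (\<sigma> 0)))"
      by (rule integral_distr[OF measurable_torus_reindex]) measurable
    also have "\<dots> = c i" unfolding S by (simp add: \<sigma>_def c_def)
    finally show ?thesis ..
  qed
  have "(\<Sum>k<n. c k) = (\<Sum>k<n. c 0)"
    by (rule sum.cong[OF refl], rule c) simp
  then have "of_nat n * c i = (\<Sum>k<n. c k)"
    unfolding c[OF assms] by simp
  also have "\<dots> = (LINT z|torus_measure. (\<Sum>k<n. sgn (coord_sum n z) * cnj (z k)))"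
    unfolding c_def by (rule Bochner_Integration.integral_sum[symmetric]) (rule int)
  also have "(\<lambda>z. \<Sum>k<n. sgn (coord_sum n z) * cnj (z k)) = (\<lambda>z. of_real (cmod (coord_sum n z)))"
  proof
    fix z
    have "(\<Sum>k<n. sgn (coord_sum n z) * cnj (z k)) = sgn (coord_sum n z) * cnj (coord_sum n z)"
      by (simp add: coord_sum_def sum_distrib_left)
    also have "\<dots> = of_real (cmod (coord_sum n z))"
      by (cases "coord_sum n z = 0") (simp_all add: sgn_eq complex_norm_square[symmetric] power2_eq_square)
    finally show "(\<Sum>k<n. sgn (coord_sum n z) * cnj (z k)) = of_real (cmod (coord_sum n z))" .
  qed
  also have "(LINT z|torus_measure. complex_of_real (cmod (coord_sum n z))) = of_real (LINT z|torus_measure. cmod (coord_sum n z))"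
    by (rule integral_complex_of_real)
  finally show ?thesis
    using assms by (simp add: sgn_coeff_def c_def field_simps)
qed

lemma fourier_coeff_choice_index:
  assumes "\<phi> \<in> PiE {..<N} (\<lambda>_. {..<n})"
  shows "fourier_coeff (sgn_prod n N) (choice_index N \<phi>) = sgn_coeff n ^ N"
proof -
  have "fourier_coeff (sgn_prod n N) (choice_index N \<phi>)
      = (LINT z|torus_measure. (\<Prod>j<N. sgn (coord_sum n (block j z)) * cnj (block j z (\<phi> j))))"
    by (simp add: fourier_coeff_def sgn_prod_def monomial_choice_index prod.distrib)
  also have "\<dots> = (\<Prod>j<N. LINT z|torus_measure. sgn (coord_sum n z) * cnj (z (\<phi> j)))"
  proof (rule integral_torus_blocks[of "\<lambda>j z. sgn (coord_sum n z) * cnj (z (\<phi> j))"])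
    show "integrable torus_measure (\<lambda>z. sgn (coord_sum n z) * cnj (z (\<phi> j)))" for j
      by (rule integrable_torus_bounded[of _ 1])
         (auto simp: norm_mult norm_sgn space_torus_measure)
  qed
  also have "\<dots> = (\<Prod>j<N. sgn_coeff n)"
    using assms by (intro prod.cong integral_sgn_coord_sum) (auto simp: PiE_iff)
  finally show ?thesis by simp
qed

lemma fourier_coeff_sgn_prod_nonzero:
  assumes \<alpha>: "\<alpha> \<in> nonneg_multiindices" and nz: "fourier_coeff (sgn_prod n N) \<alpha> \<noteq> 0"
  shows "\<alpha> \<in> choice_index N ` PiE {..<N} (\<lambda>_. {..<n})"
proof -
  have \<alpha>': "\<alpha> \<in> int_multiindices" and pos: "\<And>m. 0 \<le> \<alpha> m"
    using \<alpha> by (auto simp: nonneg_multiindices_def)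
  have fin: "finite {m. \<alpha> m \<noteq> 0}" using \<alpha>' by (simp add: int_multiindices_def)
  have out: "\<alpha> (prod_encode (j, k)) = 0" if "\<not> (j < N \<and> k < n)" for j k
  proof -
    have "(\<Sum>m | \<alpha> m \<noteq> 0 \<and> m \<in> {prod_encode (j, k)}. \<alpha> m) = 0"
    proof (rule fourier_coeff_rotate[OF measurable_sgn_prod \<alpha>' _ nz])
      fix w :: complex and z :: "nat \<Rightarrow> complex"
      have "coord_sum n (block i (\<lambda>m. (if m \<in> {prod_encode (j, k)} then w else 1) * z m)) = coord_sum n (block i z)"
        if "i < N" for i
        unfolding coord_sum_def using that \<open>\<not> (j < N \<and> k < n)\<close> by (intro sum.cong) auto
      then show "sgn_prod n N (\<lambda>m. (if m \<in> {prod_encode (j, k)} then w else 1) * z m) = w powi 0 * sgn_prod n N z"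
        by (simp add: sgn_prod_def)
    qed
    moreover have "{m. \<alpha> m \<noteq> 0 \<and> m \<in> {prod_encode (j, k)}} = (if \<alpha> (prod_encode (j, k)) \<noteq> 0 then {prod_encode (j, k)} else {})"
      by auto
    ultimately show ?thesis by (auto split: if_splits)
  qed
  have ex: "\<exists>k<n. \<forall>l. \<alpha> (prod_encode (j, l)) = (if l = k then 1 else 0)" if j: "j < N" for j
  proof -
    define J where "J = (\<lambda>k. prod_encode (j, k)) ` UNIV"
    have "(\<Sum>m | \<alpha> m \<noteq> 0 \<and> m \<in> J. \<alpha> m) = 1"
    proof (rule fourier_coeff_rotate[OF measurable_sgn_prod \<alpha>' _ nz])
      fix w :: complex and z :: "nat \<Rightarrow> complex"
      assume w: "cmod w = 1"
      have "block i (\<lambda>m. (if m \<in> J then w else 1) * z m) = (if i = j then (\<lambda>k. w * block j z k) else block i z)" for i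
        by (auto simp: J_def fun_eq_iff)
      then have "sgn (coord_sum n (block i (\<lambda>m. (if m \<in> J then w else 1) * z m)))
          = (if i = j then w else 1) * sgn (coord_sum n (block i z))" for i
        using w by (simp add: coord_sum_mult sgn_mult) (simp add: sgn_eq)
      then have "sgn_prod n N (\<lambda>m. (if m \<in> J then w else 1) * z m) = (\<Prod>i<N. (if i = j then w else 1)) * sgn_prod n N z"
        by (simp add: sgn_prod_def prod.distrib)
      also have "(\<Prod>i<N. (if i = j then w else 1)) = w" using j by (subst prod.delta) auto
      finally show "sgn_prod n N (\<lambda>m. (if m \<in> J then w else 1) * z m) = w powi 1 * sgn_prod n N z" by simp
    qed
    moreover have "(\<Sum>m | \<alpha> m \<noteq> 0 \<and> m \<in> J. \<alpha> m) = (\<Sum>k<n. \<alpha> (prod_encode (j, k)))"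
    proof -
      have "(\<Sum>k<n. \<alpha> (prod_encode (j, k))) = (\<Sum>m\<in>(\<lambda>k. prod_encode (j, k)) ` {..<n}. \<alpha> m)"
        by (subst sum.reindex) (auto simp: inj_on_def)
      also have "\<dots> = (\<Sum>m | \<alpha> m \<noteq> 0 \<and> m \<in> J. \<alpha> m)"
        by (rule sum.mono_neutral_right) (use out in \<open>force simp: J_def\<close>)+
      finally show ?thesis ..
    qed
    ultimately have sum1: "(\<Sum>k<n. \<alpha> (prod_encode (j, k))) = 1" by simp
    then obtain k where k: "k < n" "\<alpha> (prod_encode (j, k)) \<noteq> 0"
      by (metis (no_types, lifting) lessThan_iff sum.neutral zero_neq_one)
    have split: "\<alpha> (prod_encode (j, k)) + (\<Sum>l\<in>{..<n} - {k}. \<alpha> (prod_encode (j, l))) = 1"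
      using sum1 k by (subst (asm) sum.remove[of _ k]) auto
    have nn: "0 \<le> (\<Sum>l\<in>{..<n} - {k}. \<alpha> (prod_encode (j, l)))" by (intro sum_nonneg pos)
    have k1: "\<alpha> (prod_encode (j, k)) = 1" and z: "(\<Sum>l\<in>{..<n} - {k}. \<alpha> (prod_encode (j, l))) = 0"
      using split nn k(2) pos[of "prod_encode (j, k)"] by linarith+
    have "\<alpha> (prod_encode (j, l)) = 0" if "l \<noteq> k" for l
    proof (cases "l < n")
      case True
      then show ?thesis using z that by (subst (asm) sum_nonneg_eq_0_iff) (auto simp: pos)
    next
      case False
      then show ?thesis using out by simp
    qed
    then show ?thesis using k k1 by auto
  qed
  then obtain \<phi> where \<phi>: "\<And>j. j < N \<Longrightarrow> \<phi> j < n" "\<And>j l. j < N \<Longrightarrow> \<alpha> (prod_encode (j, l)) = (if l = \<phi> j then 1 else 0)"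
    by metis
  show ?thesis
  proof (rule image_eqI)
    show "restrict \<phi> {..<N} \<in> PiE {..<N} (\<lambda>_. {..<n})" using \<phi> by auto
    show "\<alpha> = choice_index N (restrict \<phi> {..<N})"
    proof
      fix m
      obtain j k where m: "m = prod_encode (j, k)" by (metis prod_decode_inverse surj_pair)
      show "\<alpha> m = choice_index N (restrict \<phi> {..<N}) m"
        unfolding m choice_index_encode using \<phi>(2)[of j k] out[of j k] by auto
    qed
  qed
qed

lemma riesz_projection_sgn_prod:
  shows "riesz_projection (sgn_prod n N) \<in> borel_measurable torus_measure"
    and "AE z in torus_measure. riesz_projection (sgn_prod n N) z = (\<Prod>j<N. sgn_coeff n * coord_sum n (block j z))"
proof -
  define B where "B = choice_index N ` PiE {..<N} (\<lambda>_. {..<n})"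
  have B: "finite B" "B \<subseteq> nonneg_multiindices"
    unfolding B_def by (intro finite_imageI finite_PiE) (auto intro: choice_index_nonneg)
  have zero: "fourier_coeff (sgn_prod n N) \<alpha> = 0" if "\<alpha> \<in> nonneg_multiindices - B" for \<alpha>
    using fourier_coeff_sgn_prod_nonzero[of \<alpha> n N] that unfolding B_def by blast
  have "(\<Sum>\<alpha>\<in>B. fourier_coeff (sgn_prod n N) \<alpha> * monomial \<alpha> z) = (\<Prod>j<N. sgn_coeff n * coord_sum n (block j z))" for z
  proof -
    have "(\<Sum>\<alpha>\<in>B. fourier_coeff (sgn_prod n N) \<alpha> * monomial \<alpha> z)
        = (\<Sum>\<phi>\<in>PiE {..<N} (\<lambda>_. {..<n}). sgn_coeff n ^ N * (\<Prod>j<N. block j z (\<phi> j)))"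
      unfolding B_def
      by (subst sum.reindex[OF inj_choice_index])
         (auto intro!: sum.cong simp: fourier_coeff_choice_index monomial_choice_index)
    also have "\<dots> = sgn_coeff n ^ N * (\<Prod>j<N. coord_sum n (block j z))"
      by (simp add: coord_sum_def prod_sum_PiE sum_distrib_left)
    also have "\<dots> = (\<Prod>j<N. sgn_coeff n * coord_sum n (block j z))"
      by (simp add: prod.distrib)
    finally show ?thesis .
  qed
  with riesz_projection_polynomial[OF B zero]
  show "riesz_projection (sgn_prod n N) \<in> borel_measurable torus_measure"
    and "AE z in torus_measure. riesz_projection (sgn_prod n N) z = (\<Prod>j<N. sgn_coeff n * coord_sum n (block j z))"
    by simp_all
qed

lemma integral_riesz_projection_sgn_prod:
  fixes q :: real
  assumes q: "0 < q" and n: "0 < n"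
  shows "(LINT z|torus_measure. cmod (riesz_projection (sgn_prod n N) z) powr q)
    = ((LINT z|torus_measure. cmod (coord_sum n z) / sqrt n) powr q *
       (LINT z|torus_measure. (cmod (coord_sum n z) / sqrt n) powr q)) ^ N"
proof -
  define a where "a = (LINT z|torus_measure. cmod (coord_sum n z))"
  have a: "0 \<le> a" unfolding a_def by (rule Bochner_Integration.integral_nonneg) simp
  have c: "cmod (sgn_coeff n) = a / real n"
    using a by (simp add: sgn_coeff_def a_def norm_divide)
  have m: "(\<lambda>z. \<Prod>j<N. sgn_coeff n * coord_sum n (block j z)) \<in> borel_measurable torus_measure"
    by (intro borel_measurable_prod borel_measurable_times borel_measurable_const
      measurable_compose[OF measurable_block measurable_coord_sum])
  have h: "(\<lambda>z. riesz_projection (sgn_prod n N) z) \<in> borel_measurable torus_measure"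
    using riesz_projection_sgn_prod(1) .
  have pw: "(\<lambda>w. cmod w powr q) \<in> borel_measurable borel" by measurable
  have "(LINT z|torus_measure. cmod (riesz_projection (sgn_prod n N) z) powr q)
      = (LINT z|torus_measure. cmod (\<Prod>j<N. sgn_coeff n * coord_sum n (block j z)) powr q)"
    using riesz_projection_sgn_prod(2)[of n N]
    by (intro integral_cong_AE measurable_compose[OF h pw] measurable_compose[OF m pw]) (auto elim!: eventually_mono)
  also have "\<dots> = (LINT z|torus_measure. (\<Prod>j<N. (a / n) powr q * cmod (coord_sum n (block j z)) powr q))"
  proof (rule Bochner_Integration.integral_cong[OF refl])
    fix z
    have "cmod (\<Prod>j<N. sgn_coeff n * coord_sum n (block j z)) powr q = (\<Prod>j<N. a / n * cmod (coord_sum n (block j z))) powr q"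
      by (simp only: prod_norm[symmetric] norm_mult c)
    also have "\<dots> = (\<Prod>j<N. (a / n * cmod (coord_sum n (block j z))) powr q)"
      by (rule prod_powr_distrib)
    finally show "cmod (\<Prod>j<N. sgn_coeff n * coord_sum n (block j z)) powr q
        = (\<Prod>j<N. (a / n) powr q * cmod (coord_sum n (block j z)) powr q)"
      by (simp only: powr_mult)
  qed
  also have "\<dots> = (\<Prod>j<N. LINT z|torus_measure. (a / n) powr q * cmod (coord_sum n z) powr q)"
    by (rule integral_torus_blocks[of "\<lambda>j z. (a / n) powr q * cmod (coord_sum n z) powr q"])
       (rule integrable_mult_right[OF integrable_coord_sum_powr(1)[OF q]])
  also have "(LINT z|torus_measure. (a / n) powr q * cmod (coord_sum n z) powr q)
     = (LINT z|torus_measure. (a / sqrt n) powr q * (cmod (coord_sum n z) / sqrt n) powr q)"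
  proof (rule Bochner_Integration.integral_cong[OF refl])
    fix z
    have "a / n * cmod (coord_sum n z) = a / sqrt n * (cmod (coord_sum n z) / sqrt n)"
      using n by simp
    then show "(a / n) powr q * cmod (coord_sum n z) powr q = (a / sqrt n) powr q * (cmod (coord_sum n z) / sqrt n) powr q"
      using a by (metis powr_mult)
  qed
  also have "\<dots> = (a / sqrt n) powr q * (LINT z|torus_measure. (cmod (coord_sum n z) / sqrt n) powr q)"
    by simp
  also have "a / sqrt n = (LINT z|torus_measure. cmod (coord_sum n z) / sqrt n)"
    by (simp add: a_def)
  finally show ?thesis by simp
qed

section \<open>Unboundedness above the root\<close>

lemma exists_coord_sum_gain:
  assumes q: "0 < q" and gap: "0 < Gamma_gap q"
  obtains n where "0 < n" "1 < (LINT z|torus_measure. cmod (coord_sum n z) / sqrt n) powr q *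
       (LINT z|torus_measure. (cmod (coord_sum n z) / sqrt n) powr q)"
proof -
  define A B where "A = sqrt pi / 2" and "B = Gamma (1 + q / 2)"
  have half: "(1 / 2 :: real) \<notin> \<int>\<^sub>\<le>\<^sub>0" by (auto dest: nonpos_Ints_nonpos)
  have A: "0 < A" "A = Gamma (1 + 1 / 2)"
    using Gamma_plus1[OF half] by (simp_all add: A_def Gamma_one_half_real add.commute)
  have B: "0 < B" unfolding B_def using q by (intro Gamma_real_pos) simp
  define c where "c = A powr q * B"
  have c: "1 < c"
  proof -
    have "ln (2 / sqrt pi) = - ln A" by (simp add: A_def ln_divide_pos)
    then have "ln c = Gamma_gap q" using A(1) B by (simp add: c_def ln_mult_pos ln_powr Gamma_gap_def B_def)
    then show ?thesis using gap A(1) B ln_gt_zero_iff[of c] by (simp add: c_def)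
  qed
  define t where "t = c powr (- 1 / (2 * (q + 1)))"
  have t: "0 < t" "t < 1"
    using c q powr_less_mono[of "- 1 / (2 * (q + 1))" 0 c] by (auto simp: t_def)
  have "- 1 / (2 * (q + 1)) * (q + 1) = - 1 / 2"
    using q by (simp add: divide_simps)
  then have "t powr (q + 1) = c powr (- 1 / 2)"
    unfolding t_def powr_powr by (simp only:)
  then have "(t * A) powr q * (t * B) = c powr (- 1 / 2) * c"
    using A(1) B t by (simp add: powr_mult powr_add c_def)
  also have "\<dots> = c powr (1 / 2)"
    using c powr_add[of c "-1/2" 1] by simp
  also have "1 < \<dots>" using c by (intro gr_one_powr) auto
  finally have gain: "1 < (t * A) powr q * (t * B)" .
  have "eventually (\<lambda>n. t * A < (LINT z|torus_measure. (cmod (coord_sum n z) / sqrt n) powr 1)) sequentially"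
    using A t by (intro eventually_moment_gt) auto
  moreover have "eventually (\<lambda>n. t * B < (LINT z|torus_measure. (cmod (coord_sum n z) / sqrt n) powr q)) sequentially"
    using B t q by (intro eventually_moment_gt) (auto simp: B_def)
  moreover have "eventually (\<lambda>n::nat. 0 < n) sequentially" by (rule eventually_gt_at_top)
  ultimately have "eventually (\<lambda>n. t * A < (LINT z|torus_measure. (cmod (coord_sum n z) / sqrt n) powr 1)
      \<and> t * B < (LINT z|torus_measure. (cmod (coord_sum n z) / sqrt n) powr q) \<and> 0 < n) sequentially"
    by eventually_elim simp
  then obtain n where n: "t * A < (LINT z|torus_measure. cmod (coord_sum n z) / sqrt n)"
      "t * B < (LINT z|torus_measure. (cmod (coord_sum n z) / sqrt n) powr q)" "0 < n"
    unfolding eventually_sequentially by auto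
  have "(t * A) powr q * (t * B) \<le> (LINT z|torus_measure. cmod (coord_sum n z) / sqrt n) powr q *
       (LINT z|torus_measure. (cmod (coord_sum n z) / sqrt n) powr q)"
    using n A(1) B t q by (intro mult_mono powr_mono2) auto
  with gain n(3) that show ?thesis by force
qed

lemma sgn_prod_Lp_infinity:
  shows "sgn_prod n N \<in> Lp \<infinity>" and "\<bar>Lp_norm \<infinity> (sgn_prod n N)\<bar> \<le> 1"
proof -
  let ?e = "esssup torus_measure (\<lambda>z. ereal (cmod (sgn_prod n N z)))"
  have m: "(\<lambda>z. ereal (cmod (sgn_prod n N z))) \<in> borel_measurable torus_measure" by measurable
  have le: "?e \<le> 1"
    by (rule esssup_I[OF m]) (simp add: norm_sgn_prod_le one_ereal_def)
  have "esssup torus_measure (\<lambda>z. 0 :: ereal) \<le> ?e"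
    by (rule esssup_mono) auto
  then have ge: "0 \<le> ?e"
    by (subst (asm) esssup_const) (simp_all add: torus.emeasure_space_1)
  show "sgn_prod n N \<in> Lp \<infinity>"
    using le by (auto simp: Lp_def intro: le_less_trans)
  show "\<bar>Lp_norm \<infinity> (sgn_prod n N)\<bar> \<le> 1"
    using le ge by (cases ?e) (auto simp: Lp_norm_def one_ereal_def)
qed

lemma not_riesz_bounded:
  fixes p :: ereal and q :: real
  assumes q: "0 < q" "0 < Gamma_gap q" and p: "p = ereal q \<or> p = \<infinity>"
  shows "\<not> riesz_bounded p"
proof
  assume "riesz_bounded p"
  then obtain C where C: "\<And>f. f \<in> Lp \<infinity> \<Longrightarrow> riesz_projection f \<in> Lp p \<and> Lp_norm p (riesz_projection f) \<le> C * Lp_norm \<infinity> f"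
    unfolding riesz_bounded_def by blast
  obtain n where n: "0 < n" and gain: "1 < (LINT z|torus_measure. cmod (coord_sum n z) / sqrt n) powr q *
       (LINT z|torus_measure. (cmod (coord_sum n z) / sqrt n) powr q)"
    using exists_coord_sum_gain[OF q] by blast
  define \<rho> where "\<rho> = (LINT z|torus_measure. cmod (coord_sum n z) / sqrt n) powr q *
       (LINT z|torus_measure. (cmod (coord_sum n z) / sqrt n) powr q)"
  have "\<rho> ^ N \<le> \<bar>C\<bar> powr q" for N
  proof -
    define h where "h = riesz_projection (sgn_prod n N)"
    have h[measurable]: "h \<in> borel_measurable torus_measure"
      unfolding h_def by (rule riesz_projection_sgn_prod(1))
    have hI: "(LINT z|torus_measure. cmod (h z) powr q) = \<rho> ^ N"
      unfolding h_def \<rho>_def by (rule integral_riesz_projection_sgn_prod[OF q(1) n])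
    have "C * Lp_norm \<infinity> (sgn_prod n N) \<le> \<bar>C * Lp_norm \<infinity> (sgn_prod n N)\<bar>" by simp
    also have "\<dots> \<le> \<bar>C\<bar> * 1"
      unfolding abs_mult by (intro mult_left_mono sgn_prod_Lp_infinity(2)) simp
    finally have hC: "h \<in> Lp p" "Lp_norm p h \<le> \<bar>C\<bar>"
      using C[OF sgn_prod_Lp_infinity(1), of n N] by (auto simp: h_def)
    show ?thesis
    proof (cases "p = \<infinity>")
      case True
      let ?e = "esssup torus_measure (\<lambda>z. ereal (cmod (h z)))"
      have e: "?e < \<infinity>" "real_of_ereal ?e \<le> \<bar>C\<bar>"
        using hC unfolding True by (simp_all add: Lp_def Lp_norm_def)
      have "?e \<le> ereal \<bar>C\<bar>" using e by (cases ?e) auto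
      then have "AE z in torus_measure. cmod (h z) \<le> \<bar>C\<bar>"
        using esssup_AE[of "\<lambda>z. ereal (cmod (h z))" torus_measure]
        by (auto elim!: eventually_mono dest: order_trans)
      then have AE: "AE z in torus_measure. cmod (h z) powr q \<le> \<bar>C\<bar> powr q"
        using q by (auto elim!: eventually_mono intro!: powr_mono2)
      have "integrable torus_measure (\<lambda>z. cmod (h z) powr q)"
        by (rule torus.integrable_const_bound[of _ "\<bar>C\<bar> powr q"]) (use AE in auto)
      from torus.integral_le_const[OF this AE] show ?thesis unfolding hI .
    next
      case False
      then have "p = ereal q" using p by simp
      then have "(\<rho> ^ N) powr (1 / q) \<le> \<bar>C\<bar>"
        using hC(2) by (simp add: Lp_norm_def hI)
      then have "((\<rho> ^ N) powr (1 / q)) powr q \<le> \<bar>C\<bar> powr q"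
        using q by (intro powr_mono2) auto
      moreover have "0 < \<rho> ^ N" using gain by (simp add: \<rho>_def)
      ultimately show ?thesis using q by (simp add: powr_powr)
    qed
  qed
  moreover obtain N where "\<bar>C\<bar> powr q < \<rho> ^ N"
    using real_arch_pow[of \<rho> "\<bar>C\<bar> powr q"] gain by (auto simp: \<rho>_def)
  ultimately show False by (meson not_le)
qed

theorem theorem1:
  shows "\<exists>p::real.
    (0 < p \<and> Gamma (1 + p / 2) powr (1 / p) = 2 / sqrt pi) \<and>
    (\<forall>q::real. 0 < q \<and> Gamma (1 + q / 2) powr (1 / q) = 2 / sqrt pi \<longrightarrow> q = p) \<and>
    \<bar>p - 3.31138\<bar> < 0.000005 \<and>
    p_infty \<le> ereal p"
proof -
  obtain p where p: "3.311375 < p" "p < 3.311385" "Gamma_gap p = 0"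
    "\<And>q. 0 < q \<Longrightarrow> Gamma_gap q = 0 \<Longrightarrow> q = p" "\<And>q. p < q \<Longrightarrow> 0 < Gamma_gap q"
    using Gamma_gap_root by blast
  have p0: "0 < p" by (rule less_trans[OF _ p(1)]) simp
  have "p_infty \<le> ereal p"
    unfolding p_infty_def
  proof (rule Sup_least)
    fix r :: ereal assume r: "r \<in> {p. 2 \<le> p \<and> riesz_bounded p}"
    show "r \<le> ereal p"
    proof (rule ccontr)
      assume "\<not> r \<le> ereal p"
      then have "\<exists>q. p < q \<and> (r = ereal q \<or> r = \<infinity>)"
        by (cases r) (auto intro: exI[of _ "p + 1"])
      then obtain q where q: "p < q" "r = ereal q \<or> r = \<infinity>" by blast
      have "0 < q" using p0 q(1) by linarith
      from not_riesz_bounded[OF this p(5)[OF q(1)] q(2)] show False using r by simp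
    qed
  qed
  moreover have "\<bar>p - 3.31138\<bar> < 0.000005" using p(1,2) by (simp add: abs_if field_simps)
  ultimately show ?thesis
    using p(3,4) p0 Gamma_gap_root_iff by blast
qed

end
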